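(* Let $\alpha>0$, $c\ge1$, $R>0$, $\kappa_c=L(\Lambda_c)/\alpha$, and suppose the ACGD-S method (described in the context) is run with the following stepsizes. Outer loop, for $t\ge1$: $$\tau_t=\min\{\tfrac{t-1}2,\sqrt{2\kappa_c}\},\quad\eta_t=\frac{L(\Lambda_c)}{\tau_{t+1}},\quad\theta_t=\frac{\tau_t}{\tau_{t-1}+1},\quad\omega_1=1,\ \omega_t=\omega_{t-1}/\theta_t\ (t\ge2).$$ Inner loops: $M_t=\|\nu^t\|$ if $\|\nu^t\|>0$, $M_t=1$ otherwise, and $\Delta=\frac{R^2}{\alpha L(\Lambda_c)}$. In phase $1$, $S_1=\min\{S\in\mathbb N_+:\sum_{s=1}^Ss\ge\omega_1M_1^2\Delta\}$ and, for $s\in\{1,\dots,S_1\}$, $$\delta^{(1)}_s=\frac{s}{\Gamma_1},\quad\beta^{(1)}_s=\frac\alpha4(s-1),\quad\gamma^{(1)}_s=\frac4\alpha\frac{M_1^2\Gamma_1}{\delta^{(1)}_s},\quad W_2=\frac{\delta^{(1)}_{S_1}}{M_1},$$ where $\Gamma_1\ge0$ is the non-negative root of $\sum_{s=1}^{S_1}s=\Gamma_1^2\,\omega_1M_1^2\Delta$. In phases $t\ge2$, $S_t$ and $\Gamma_t\ge0$ are given by $$S_t=\min\Big\{S\in\mathbb N_+:\sum_{s=1}^S[W_tM_t+(s-1)]\ge\omega_tM_t^2\Delta\Big\},\qquad\sum_{s=1}^{S_t}[\Gamma_tW_tM_t+(s-1)]=\Gamma_t^2\,\omega_tM_t^2\Delta,$$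 and $$\delta^{(t)}_s=W_tM_t+\frac{s-1}{\Gamma_t},\quad\gamma^{(t)}_s=\frac4\alpha\frac{M_t^2\Gamma_t}{\delta^{(t)}_s},\quad\beta^{(t)}_s=\begin{cases}\frac\alpha4W_t\Gamma_tM_t&s=1,\\\frac\alpha4[W_t\Gamma_tM_t+(s-2)]&s\ge2,\end{cases}\quad W_{t+1}=\frac{\delta^{(t)}_{S_t}}{M_t}.$$ The extrapolation parameters are $\rho^{(t)}_s=\delta^{(t)}_{s-1}/\delta^{(t)}_s$ for $s\ge2$ and $\rho^{(t)}_1=w^{(t-1)}_{S_{t-1}}/w^{(t)}_1$ for $t\ge2$, where $w^{(t)}_s=\omega_t\delta^{(t)}_s/\sum_{s'=1}^{S_t}\delta^{(t)}_{s'}$. Then $M_t\le\bar M$ for all $t$, where $\bar M$ is an upper bound of $\max\{1,\|\nabla g(x)\|\}$ for $x$ in some bounded neighborhood of $x^*$, and the ergodic average $\bar x^N=\sum_{t=1}^N\omega_tx^t/\sum_{t=1}^N\omega_t$ satisfies $$\max\{F(\bar x^N)-F_*,\ c\|[g(\bar x^N)]_+\|\}\le\frac{L(\Lambda_c)}{\mathcal W_N}\Big(\frac{2d(\Lambda_c)^2}{R^2}+\|x^0-x^*\|^2\Big),$$ $$\|\bar x^N-x^*\|^2\le\frac{2L(\Lambda_c)}{\alpha\mathcal W_N}\Big(\frac{2d(\Lambda_c)^2}{R^2}+\|x^0-x^*\|^2\Big),$$ where $d(\Lambda_c)=\|\lambda^*\|+c$ and $\mathcal W_N=\sum_{t=1}^N\omega_t$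 satisfies $\mathcal W_N\ge\max\{N(N+1)/2,\ \sqrt{2\kappa_c}[(1+1/\sqrt{2\kappa_c})^{N-4}-1]\}$.
   Context: Problem: $\min_{x\in X}\{F(x):=f(x)+u(x)\}$ subject to $g(x)\le 0$, where $X\subseteq\mathbb R^n$ is closed and convex, $f:\mathbb R^n\to\mathbb R$ and $g=(g_1,\dots,g_m):\mathbb R^n\to\mathbb R^m$ are convex (componentwise) and differentiable with Lipschitz continuous gradients, and $u$ is a convex, $\alpha$-strongly convex function. Norms are Euclidean (operator norm for matrices), $[\cdot]_+$ is the componentwise positive part, $\nabla g(x)$ is the $m\times n$ Jacobian. There is a KKT pair: $x^*\in X$ optimal, $\lambda^*\in\mathbb R^m_+$ with $-[\nabla f(x^* )+\sum_i\lambda_i^*\nabla g_i(x^* )+u']\in N_X(x^* )$ for some $u'\in\partial u(x^* )$, $g(x^* )\le0$, $\lambda^*_ig_i(x^* )=0$ for all $i$; $F_*=F(x^* )$. For $\lambda\in\mathbb R^m_+$, $L_\lambda$ is a Lipschitz constant on $\mathbb R^n$ of the gradient of $f+\sum_i\lambda_ig_i$; $L(\Lambda)=\sup_{\lambda\in\Lambda}L_\lambda$; $\Lambda_r=\{0\}\cup\{\lambda^*+\lambda:\lambda\in\mathbb R^m_+,\|\lambda\|\le r\}$. Convention: the Lipschitz constant $L_f$ of $\nabla f$ is chosen with $L_f\ge\alpha$, so $\kappa_c\ge1$. ACGD-S method: $x^{-1}=\underline x^0=y^{(1)}_0=x^0\in X$, $\pi^0=\nabla f(x^0)$, $\nu^0=\nabla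 g(x^0)$, $\lambda^{(1)}_{-1}=\lambda^{(1)}_0=0$. For phases $t=1,\dots,N$: 1. $\tilde x^t=x^{t-1}+\theta_t(x^{t-1}-x^{t-2})$, $\underline x^t=(\tau_t\underline x^{t-1}+\tilde x^t)/(1+\tau_t)$, $\pi^t=\nabla f(\underline x^t)$, $\nu^t=\nabla g(\underline x^t)$; compute $S_t$ and the inner parameters. 2. For $s=1,\dots,S_t$: $\tilde h^{(t),s}=(\nu^t)^\top\lambda^{(t)}_0+\rho^{(t)}_1(\nu^{t-1})^\top(\lambda^{(t)}_0-\lambda^{(t)}_{-1})$ if $s=1$, and $\tilde h^{(t),s}=(\nu^t)^\top\lambda^{(t)}_{s-1}+\rho^{(t)}_s(\nu^t)^\top(\lambda^{(t)}_{s-1}-\lambda^{(t)}_{s-2})$ otherwise ($\rho^{(1)}_1$ is immaterial because $\lambda^{(1)}_0=\lambda^{(1)}_{-1}$); $y^{(t)}_s=\operatorname{argmin}_{y\in X}\langle\tilde h^{(t),s}+\pi^t,y\rangle+u(y)+\frac{\eta_t}2\|y-x^{t-1}\|^2+\frac{\beta^{(t)}_s}2\|y-y^{(t)}_{s-1}\|^2$; $\lambda^{(t)}_s=\operatorname{argmax}_{\lambda\in\mathbb R^m_+}\langle\lambda,\nu^t(y^{(t)}_s-\underline x^t)+g(\underline x^t)\rangle-\frac{\gamma^{(t)}_s}2\|\lambda-\lambda^{(t)}_{s-1}\|^2$. 3. $\lambda^{(t+1)}_0=\lambda^{(t)}_{S_t}$, $\lambda^{(t+1)}_{-1}=\lambda^{(t)}_{S_t-1}$,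 $y^{(t+1)}_0=y^{(t)}_{S_t}$; $x^t=\sum_s\delta^{(t)}_sy^{(t)}_s/\sum_s\delta^{(t)}_s$, $\tilde\lambda^t=\sum_s\delta^{(t)}_s\lambda^{(t)}_s/\sum_s\delta^{(t)}_s$. *)

theory Defs
  imports "HOL-Analysis.Analysis"
begin

definition gradient :: "('a::real_inner \<Rightarrow> real) \<Rightarrow> 'a \<Rightarrow> 'a" where
  "gradient h x = (THE D. GDERIV h x :> D)"

text \<open>The Euclidean operator norm of a matrix; \<^const>\<open>norm\<close> on \<open>real^'n^'m\<close> would be the
  Frobenius norm.\<close>

definition matrix_norm :: "real^'n^'m \<Rightarrow> real" where
  "matrix_norm A = onorm (\<lambda>v. A *v v)"

definition strongly_convex_on :: "'a::real_normed_vector set \<Rightarrow> real \<Rightarrow> ('a \<Rightarrow> real) \<Rightarrow> bool" where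
  "strongly_convex_on C \<mu> h \<longleftrightarrow> convex C \<and>
     (\<forall>x\<in>C. \<forall>y\<in>C. \<forall>t\<in>{0..1}.
        h ((1 - t) *\<^sub>R x + t *\<^sub>R y)
          \<le> (1 - t) * h x + t * h y - \<mu> / 2 * t * (1 - t) * (norm (x - y))\<^sup>2)"

text \<open>Subdifferential of a function with domain \<open>C\<close> (that is, \<open>+\<infinity>\<close> outside \<open>C\<close>).\<close>

definition subdifferential_on :: "'a::real_inner set \<Rightarrow> ('a \<Rightarrow> real) \<Rightarrow> 'a \<Rightarrow> 'a set" where
  "subdifferential_on C h x = {v. \<forall>y\<in>C. h y \<ge> h x + v \<bullet> (y - x)}"

definition normal_cone :: "'a::real_inner set \<Rightarrow> 'a \<Rightarrow> 'a set" where
  "normal_cone C x = {v. \<forall>y\<in>C. v \<bullet> (y - x) \<le> 0}"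

definition pos_part :: "real^'m \<Rightarrow> real^'m" where
  "pos_part v = (\<chi> i. max 0 (v $ i))"

text \<open>On vectors \<open>\<le>\<close> is the componentwise order, so \<open>0 \<le> l\<close> describes the nonnegative orthant.\<close>

definition multiplier_set :: "real^'m \<Rightarrow> real \<Rightarrow> (real^'m) set" where
  "multiplier_set lam_star r = {0} \<union> {lam_star + l | l. 0 \<le> l \<and> norm l \<le> r}"

definition tau :: "real \<Rightarrow> nat \<Rightarrow> real" where
  "tau \<kappa> t = min ((real t - 1) / 2) (sqrt (2 * \<kappa>))"

definition eta :: "real \<Rightarrow> real \<Rightarrow> nat \<Rightarrow> real" where
  "eta Lc \<kappa> t = Lc / tau \<kappa> (t + 1)"

text \<open>\<open>theta \<kappa> 1 = 0\<close>, whatever convention is used for \<open>tau \<kappa> 0\<close>, because \<open>tau \<kappa> 1 = 0\<close> for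
  \<open>\<kappa> \<ge> 0\<close> (and the first extrapolation direction vanishes anyway).\<close>

definition theta :: "real \<Rightarrow> nat \<Rightarrow> real" where
  "theta \<kappa> t = tau \<kappa> t / (tau \<kappa> (t - 1) + 1)"

text \<open>Only the values at \<open>t \<ge> 1\<close> matter.\<close>

fun omega :: "real \<Rightarrow> nat \<Rightarrow> real" where
  "omega \<kappa> 0 = 1"
| "omega \<kappa> (Suc 0) = 1"
| "omega \<kappa> (Suc (Suc t)) = omega \<kappa> (Suc t) / theta \<kappa> (Suc (Suc t))"

text \<open>The numbers \<open>M t\<close>, \<open>\<Gamma> t\<close>, \<open>W t\<close>, \<open>S t\<close> are produced during the run,
  so the inner stepsizes are functions of these sequences.\<close>

definition phase_M :: "(real^'n \<Rightarrow> real^'m) \<Rightarrow> (nat \<Rightarrow> real^'n) \<Rightarrow> nat \<Rightarrow> real" where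
  "phase_M g xu t =
     (let m = matrix_norm (jacobian g (at (xu t))) in if m > 0 then m else 1)"

definition delta ::
  "(nat \<Rightarrow> real) \<Rightarrow> (nat \<Rightarrow> real) \<Rightarrow> (nat \<Rightarrow> real) \<Rightarrow> nat \<Rightarrow> nat \<Rightarrow> real" where
  "delta M \<Gamma> W t s =
     (if t = 1 then real s / \<Gamma> 1 else W t * M t + (real s - 1) / \<Gamma> t)"

definition beta ::
  "real \<Rightarrow> (nat \<Rightarrow> real) \<Rightarrow> (nat \<Rightarrow> real) \<Rightarrow> (nat \<Rightarrow> real) \<Rightarrow> nat \<Rightarrow> nat \<Rightarrow> real" where
  "beta \<alpha> M \<Gamma> W t s =
     (if t = 1 then \<alpha> / 4 * (real s - 1)
      else if s = 1 then \<alpha> / 4 * (W t * \<Gamma> t * M t)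
      else \<alpha> / 4 * (W t * \<Gamma> t * M t + (real s - 2)))"

definition gamma ::
  "real \<Rightarrow> (nat \<Rightarrow> real) \<Rightarrow> (nat \<Rightarrow> real) \<Rightarrow> (nat \<Rightarrow> real) \<Rightarrow> nat \<Rightarrow> nat \<Rightarrow> real" where
  "gamma \<alpha> M \<Gamma> W t s = 4 / \<alpha> * ((M t)\<^sup>2 * \<Gamma> t / delta M \<Gamma> W t s)"

definition weight ::
  "real \<Rightarrow> (nat \<Rightarrow> real) \<Rightarrow> (nat \<Rightarrow> real) \<Rightarrow> (nat \<Rightarrow> real) \<Rightarrow> (nat \<Rightarrow> nat) \<Rightarrow> nat \<Rightarrow> nat \<Rightarrow> real" where
  "weight \<kappa> M \<Gamma> W S t s =
     omega \<kappa> t * delta M \<Gamma> W t s / (\<Sum>s'=1..S t. delta M \<Gamma> W t s')"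

text \<open>The value \<open>rho \<dots> 1 1\<close> refers to a nonexistent phase \<open>0\<close>; it is immaterial, because it
  multiplies the zero vector.\<close>

definition rho ::
  "real \<Rightarrow> (nat \<Rightarrow> real) \<Rightarrow> (nat \<Rightarrow> real) \<Rightarrow> (nat \<Rightarrow> real) \<Rightarrow> (nat \<Rightarrow> nat) \<Rightarrow> nat \<Rightarrow> nat \<Rightarrow> real" where
  "rho \<kappa> M \<Gamma> W S t s =
     (if s \<ge> 2 then delta M \<Gamma> W t (s - 1) / delta M \<Gamma> W t s
      else weight \<kappa> M \<Gamma> W S (t - 1) (S (t - 1)) / weight \<kappa> M \<Gamma> W S t 1)"

text \<open>In a phase \<open>t \<ge> 2\<close> with \<open>S t = 1\<close>, the equation for \<open>\<Gamma> t\<close> also has the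
  degenerate root \<open>0\<close>, for which the dual stepsizes would vanish; \<open>\<Gamma> t\<close> is the unique
  positive root.\<close>

definition inner_params ::
  "real \<Rightarrow> real \<Rightarrow> nat \<Rightarrow> (nat \<Rightarrow> real) \<Rightarrow> (nat \<Rightarrow> nat) \<Rightarrow> (nat \<Rightarrow> real) \<Rightarrow> (nat \<Rightarrow> real) \<Rightarrow> bool"
  where
  "inner_params \<kappa> \<Delta> N M S \<Gamma> W \<longleftrightarrow>
     S 1 = (LEAST n. n \<ge> 1 \<and> (\<Sum>s=1..n. real s) \<ge> omega \<kappa> 1 * (M 1)\<^sup>2 * \<Delta>) \<and>
     \<Gamma> 1 \<ge> 0 \<and> (\<Sum>s=1..S 1. real s) = (\<Gamma> 1)\<^sup>2 * omega \<kappa> 1 * (M 1)\<^sup>2 * \<Delta> \<and>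
     (\<forall>t\<in>{2..N}.
        S t = (LEAST n. n \<ge> 1 \<and>
                 (\<Sum>s=1..n. W t * M t + (real s - 1)) \<ge> omega \<kappa> t * (M t)\<^sup>2 * \<Delta>) \<and>
        \<Gamma> t > 0 \<and>
        (\<Sum>s=1..S t. \<Gamma> t * W t * M t + (real s - 1)) = (\<Gamma> t)\<^sup>2 * omega \<kappa> t * (M t)\<^sup>2 * \<Delta>) \<and>
     (\<forall>t\<in>{1..N}. W (t + 1) = delta M \<Gamma> W t (S t) / M t)"

text \<open>The predicate says that the given sequences form a run of \<open>N \<ge> 1\<close> phases:
  \<open>x t\<close> and \<open>xu t\<close> are the (underlined) outer iterates,
  \<open>y t s\<close> and \<open>lam t s\<close> are the inner iterates of phase \<open>t\<close>,
  and \<open>lamm t\<close> is the inner dual iterate of phase \<open>t\<close> with index \<open>-1\<close>.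
  Truncated subtraction gives \<open>x (1 - 2) = x 0\<close>, which is the convention
  for the iterate with index \<open>-1\<close>.\<close>

definition acgd_s_run ::
  "(real^'n \<Rightarrow> real) \<Rightarrow> (real^'n \<Rightarrow> real^'m) \<Rightarrow> (real^'n \<Rightarrow> real) \<Rightarrow> (real^'n) set \<Rightarrow>
   real \<Rightarrow> real \<Rightarrow> real \<Rightarrow> real^'n \<Rightarrow> nat \<Rightarrow>
   (nat \<Rightarrow> real^'n) \<Rightarrow> (nat \<Rightarrow> real^'n) \<Rightarrow> (nat \<Rightarrow> nat \<Rightarrow> real^'n) \<Rightarrow>
   (nat \<Rightarrow> nat \<Rightarrow> real^'m) \<Rightarrow> (nat \<Rightarrow> real^'m) \<Rightarrow>
   (nat \<Rightarrow> nat) \<Rightarrow> (nat \<Rightarrow> real) \<Rightarrow> (nat \<Rightarrow> real) \<Rightarrow> bool" where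
  "acgd_s_run f g u X \<alpha> Lc R x0 N x xu y lam lamm S \<Gamma> W \<longleftrightarrow>
    (let \<kappa> = Lc / \<alpha>;
         \<Delta> = R\<^sup>2 / (\<alpha> * Lc);
         \<pi> = (\<lambda>t. gradient f (xu t));
         \<nu> = (\<lambda>t. jacobian g (at (xu t)));
         M = phase_M g xu;
         \<delta> = delta M \<Gamma> W;
         \<beta> = beta \<alpha> M \<Gamma> W;
         \<gamma> = gamma \<alpha> M \<Gamma> W;
         \<rho> = rho \<kappa> M \<Gamma> W S;
         h = (\<lambda>t s. if s = 1
                then transpose (\<nu> t) *v lam t 0
                     + \<rho> t 1 *\<^sub>R (transpose (\<nu> (t - 1)) *v (lam t 0 - lamm t))
                else transpose (\<nu> t) *v lam t (s - 1)
                     + \<rho> t s *\<^sub>R (transpose (\<nu> t) *v (lam t (s - 1) - lam t (s - 2))))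
     in inner_params \<kappa> \<Delta> N M S \<Gamma> W \<and>
        x 0 = x0 \<and> xu 0 = x0 \<and> y 1 0 = x0 \<and> lam 1 0 = 0 \<and> lamm 1 = 0 \<and>
        (\<forall>t\<in>{1..N}.
           xu t = (tau \<kappa> t *\<^sub>R xu (t - 1)
                   + (x (t - 1) + theta \<kappa> t *\<^sub>R (x (t - 1) - x (t - 2)))) /\<^sub>R (1 + tau \<kappa> t) \<and>
           (\<forall>s\<in>{1..S t}.
              is_arg_min
                (\<lambda>v. (h t s + \<pi> t) \<bullet> v + u v
                     + eta Lc \<kappa> t / 2 * (norm (v - x (t - 1)))\<^sup>2
                     + \<beta> t s / 2 * (norm (v - y t (s - 1)))\<^sup>2)
                (\<lambda>v. v \<in> X) (y t s) \<and>
              is_arg_max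
                (\<lambda>l. l \<bullet> (\<nu> t *v (y t s - xu t) + g (xu t))
                     - \<gamma> t s / 2 * (norm (l - lam t (s - 1)))\<^sup>2)
                (\<lambda>l. 0 \<le> l) (lam t s)) \<and>
           lam (t + 1) 0 = lam t (S t) \<and>
           lamm (t + 1) = lam t (S t - 1) \<and>
           y (t + 1) 0 = y t (S t) \<and>
           x t = (\<Sum>s=1..S t. \<delta> t s *\<^sub>R y t s) /\<^sub>R (\<Sum>s=1..S t. \<delta> t s)))"

definition ergodic_average :: "real \<Rightarrow> (nat \<Rightarrow> 'a::real_vector) \<Rightarrow> nat \<Rightarrow> 'a" where
  "ergodic_average \<kappa> x N = (\<Sum>t=1..N. omega \<kappa> t *\<^sub>R x t) /\<^sub>R (\<Sum>t=1..N. omega \<kappa> t)"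

end

theory Submission
  imports Defs
begin

text \<open>The proof is a primal-dual potential argument. For a nonnegative multiplier \<open>l\<close> let
  \<open>h = f + \<langle>l, g\<rangle>\<close>; this function is convex, and for \<open>l\<close> in \<open>multiplier_set lam_star c\<close> its
  gradient is \<open>Lc\<close>-Lipschitz. Let \<open>xh\<close> be any point. For an iterate \<open>x t\<close>, the tangent of \<open>h\<close> at \<open>xh\<close>
  plus \<open>u\<close>, minus \<open>F x_star\<close>, splits into two parts, which correspond to the two loops.

  The first part is the difference between the tangents at \<open>xh\<close> and at \<open>xu t\<close>. The averaging that
  defines \<open>xu t\<close> turns it into a telescoping difference of Bregman distances plus an extrapolation
  error; the error is absorbed with the inequality
  \<open>\<parallel>\<nabla>h x - \<nabla>h z\<parallel>\<^sup>2 \<le> 2 Lc (h x - h z - \<langle>\<nabla>h z, x - z\<rangle>)\<close> (\<open>Bregman_ge_gradient_difference\<close>) and the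
  proximal terms of the outer loop. This is \<open>outer_step\<close>.

  The second part is the duality gap of the linearized problem of phase \<open>t\<close>, to which the inner loop
  applies a primal-dual iteration with extrapolated multipliers. Each inner step decreases a potential
  (\<open>inner_step\<close>). The inner stepsizes are designed so that three things happen even across the
  boundary between two phases: the weighted dual stepsize \<open>w \<gamma>\<close> has the constant value
  \<open>4 Lc / R\<^sup>2\<close>, the weighted primal distances telescope, and the extrapolation errors are covered
  (\<open>step_within_phase\<close>, \<open>step_between_phases\<close>). The strong convexity of \<open>u\<close> is split in halves, one
  for the inner loop and one for the outer loop.

  Summation over all phases with \<open>xh\<close> equal to the ergodic average gives \<open>ergodic_estimate\<close>: the
  value of the Lagrangian at the average minus \<open>F x_star\<close>, times the sum of the weights, plus a
  multiple of \<open>\<parallel>x n - x_star\<parallel>\<^sup>2\<close>, is bounded by the initial potential. The multiplier \<open>0\<close> yields the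
  optimality gap; \<open>lam_star\<close> plus a vector of length \<open>c\<close> in the direction of the positive part of the
  constraints yields the infeasibility; and \<open>lam_star\<close> yields the distance to \<open>x_star\<close>, since there the
  Lagrangian grows quadratically (\<open>lagrangian_growth\<close>). With \<open>lam_star\<close> the extra summand also
  confines the points \<open>x t\<close> to a ball whose radius depends neither on the run nor on its length. An
  enlarged ball contains the points \<open>xu t\<close> as well (\<open>xu_bounded\<close>) and is the neighbourhood on which
  the Jacobians are bounded.\<close>

section \<open>Convex functions with Lipschitz gradients\<close>

lemma gradient_eqI:
  assumes "GDERIV h x :> D"
  shows "gradient h x = D"
  unfolding gradient_def
proof (rule the_equality)
  fix D' assume "GDERIV h x :> D'"
  then have "(\<lambda>v. v \<bullet> D') = (\<lambda>v. v \<bullet> D)"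
    using assms by (auto simp: gderiv_def intro: has_derivative_unique)
  then show "D' = D"
    by (metis inner_commute vector_eq_rdot)
qed (fact assms)

lemma GDERIV_gradient:
  fixes h :: "'a::euclidean_space \<Rightarrow> real"
  assumes "h differentiable (at x)"
  shows "GDERIV h x :> gradient h x"
proof -
  obtain h' where h': "(h has_derivative h') (at x)"
    using assms by (auto simp: differentiable_def)
  have "h' = (\<lambda>v. v \<bullet> adjoint h' 1)"
    using adjoint_works[OF has_derivative_linear[OF h']] by auto
  then have "GDERIV h x :> adjoint h' 1"
    using h' by (simp add: gderiv_def)
  then show ?thesis
    using gradient_eqI by metis
qed

lemma GDERIV_along_line:
  assumes "GDERIV h (x + t *\<^sub>R d) :> D"
  shows "((\<lambda>t. h (x + t *\<^sub>R d)) has_real_derivative D \<bullet> d) (at t)"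
proof -
  have "((\<lambda>t. x + t *\<^sub>R d) has_derivative (\<lambda>s. s *\<^sub>R d)) (at t)"
    by (auto intro!: derivative_eq_intros)
  then have "((h \<circ> (\<lambda>t. x + t *\<^sub>R d)) has_derivative ((\<lambda>v. v \<bullet> D) \<circ> (\<lambda>s. s *\<^sub>R d))) (at t)"
    using assms by (intro diff_chain_at) (auto simp: gderiv_def)
  then show ?thesis
    by (simp add: has_field_derivative_def o_def inner_commute mult.commute[of _ "D \<bullet> d"])
qed

lemma convex_above_tangent:
  fixes h :: "'a::real_inner \<Rightarrow> real"
  assumes "convex_on UNIV h" "GDERIV h x :> D"
  shows "h y \<ge> h x + D \<bullet> (y - x)"
proof -
  let ?p = "\<lambda>t. h (x + t *\<^sub>R (y - x))"
  have "convex_on UNIV ?p"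
  proof (rule convex_onI)
    fix t r s :: real
    assume t: "0 < t" "t < 1"
    have "x + ((1 - t) *\<^sub>R r + t *\<^sub>R s) *\<^sub>R (y - x)
        = (1 - t) *\<^sub>R (x + r *\<^sub>R (y - x)) + t *\<^sub>R (x + s *\<^sub>R (y - x))"
      by (simp add: algebra_simps)
    then show "?p ((1 - t) *\<^sub>R r + t *\<^sub>R s) \<le> (1 - t) * ?p r + t * ?p s"
      using convex_onD[OF assms(1), of t "x + r *\<^sub>R (y - x)" "x + s *\<^sub>R (y - x)"] t by simp
  qed auto
  moreover have "(?p has_real_derivative D \<bullet> (y - x)) (at 0)"
    using GDERIV_along_line[of h x 0 "y - x" D] assms(2) by simp
  ultimately have "?p 1 - ?p 0 \<ge> D \<bullet> (y - x) * (1 - 0)"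
    by (intro convex_on_imp_above_tangent[of UNIV]) auto
  then show ?thesis by simp
qed

text \<open>Along the segment from \<open>x\<close> to \<open>y\<close> the slope grows at most at rate
  \<open>K \<parallel>y - x\<parallel>\<^sup>2\<close>, so subtracting the corresponding parabola leaves a decreasing function.\<close>

lemma Lipschitz_gradient_upper_bound:
  fixes h :: "'a::real_inner \<Rightarrow> real"
  assumes G: "\<And>z. GDERIV h z :> G z" and lip: "K-lipschitz_on UNIV G"
  shows "h y \<le> h x + G x \<bullet> (y - x) + K / 2 * (norm (y - x))\<^sup>2"
proof -
  let ?d = "y - x"
  let ?q = "\<lambda>t. h (x + t *\<^sub>R ?d) - t * (G x \<bullet> ?d) - K / 2 * t\<^sup>2 * (norm ?d)\<^sup>2"
  have "?q 1 \<le> ?q 0"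
  proof (rule DERIV_nonpos_imp_nonincreasing[of 0 1 ?q])
    fix t :: real assume t: "0 \<le> t" "t \<le> 1"
    let ?e = "G (x + t *\<^sub>R ?d) \<bullet> ?d - G x \<bullet> ?d - K * t * (norm ?d)\<^sup>2"
    have "(?q has_real_derivative ?e) (at t)"
      by (auto intro!: derivative_eq_intros GDERIV_along_line G)
    moreover have "?e \<le> 0"
    proof -
      have "(G (x + t *\<^sub>R ?d) - G x) \<bullet> ?d \<le> norm (G (x + t *\<^sub>R ?d) - G x) * norm ?d"
        by (rule norm_cauchy_schwarz)
      also have "\<dots> \<le> (K * norm (t *\<^sub>R ?d)) * norm ?d"
        using lipschitz_onD[OF lip, of "x + t *\<^sub>R ?d" x]
        by (intro mult_right_mono) (auto simp: dist_norm)
      also have "norm (t *\<^sub>R ?d) = t * norm ?d"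
        using t by simp
      finally show ?thesis
        unfolding inner_diff_left power2_eq_square by (simp add: mult.assoc)
    qed
    ultimately show "\<exists>e. (?q has_real_derivative e) (at t) \<and> e \<le> 0" by blast
  qed auto
  then show ?thesis by simp
qed

text \<open>The function \<open>h - \<langle>G z, \<cdot>\<rangle>\<close> is minimal at \<open>z\<close>; a gradient step of length \<open>1 / K\<close>
  from \<open>x\<close> cannot undercut this minimum.\<close>

lemma Bregman_ge_gradient_difference:
  fixes h :: "'a::real_inner \<Rightarrow> real"
  assumes conv: "convex_on UNIV h" and G: "\<And>z. GDERIV h z :> G z"
    and lip: "K-lipschitz_on UNIV G" and K: "K > 0"
  shows "h x - h z - G z \<bullet> (x - z) \<ge> (norm (G x - G z))\<^sup>2 / (2 * K)"
proof -
  let ?v = "G x - G z"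
  let ?w = "x - (1 / K) *\<^sub>R ?v"
  have "h z + G z \<bullet> (?w - z) \<le> h ?w"
    using convex_above_tangent[OF conv G] .
  also have "\<dots> \<le> h x + G x \<bullet> (?w - x) + K / 2 * (norm (?w - x))\<^sup>2"
    using Lipschitz_gradient_upper_bound[OF G lip] .
  finally have "h z + G z \<bullet> (?w - z) \<le> h x + G x \<bullet> (?w - x) + K / 2 * (norm (?w - x))\<^sup>2" .
  moreover have "G z \<bullet> (?w - z) = G z \<bullet> (x - z) - (G z \<bullet> ?v) / K"
    by (simp add: inner_diff_right[of _ _ "_ *\<^sub>R _"] inner_diff_right[of _ _ z])
  moreover have "G x \<bullet> (?w - x) = - ((G x \<bullet> ?v) / K)"
    by simp
  moreover have "G x \<bullet> ?v - G z \<bullet> ?v = (norm ?v)\<^sup>2"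
    by (simp add: inner_diff_left[symmetric] power2_norm_eq_inner)
  then have "(G x \<bullet> ?v) / K = (G z \<bullet> ?v) / K + (norm ?v)\<^sup>2 / K"
    by (simp add: add_divide_distrib[symmetric])
  moreover have w: "norm (?w - x) = norm ?v / K"
    using K by simp
  have "K / 2 * (norm (?w - x))\<^sup>2 = (norm ?v)\<^sup>2 / (2 * K)"
    unfolding w using K by (simp add: power2_eq_square field_simps)
  moreover have "(norm ?v)\<^sup>2 / K = 2 * ((norm ?v)\<^sup>2 / (2 * K))"
    using K by (simp add: field_simps)
  ultimately show ?thesis by linarith
qed

section \<open>Strong convexity\<close>

text \<open>Comparing a minimizer with a point of the segment towards \<open>v\<close> and letting that point tend
  to the minimizer gives the full quadratic gap.\<close>

lemma strongly_convex_minimizer_gap: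
  assumes sc: "strongly_convex_on C \<mu> h" and z: "is_arg_min h (\<lambda>v. v \<in> C) z" and v: "v \<in> C"
  shows "h z + \<mu> / 2 * (norm (v - z))\<^sup>2 \<le> h v"
proof -
  let ?a = "\<mu> / 2 * (norm (v - z))\<^sup>2"
  have zC: "z \<in> C" and C: "convex C" and min: "\<And>w. w \<in> C \<Longrightarrow> h z \<le> h w"
    using z sc by (auto simp: is_arg_min_linorder strongly_convex_on_def)
  have "h z + (1 - t) * ?a \<le> h v" if t: "0 < t" "t < 1" for t
  proof -
    have "h z \<le> h ((1 - t) *\<^sub>R z + t *\<^sub>R v)"
      using t zC v by (intro min convexD[OF C]) auto
    also have "\<dots> \<le> (1 - t) * h z + t * h v - \<mu> / 2 * t * (1 - t) * (norm (z - v))\<^sup>2"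
      using sc zC v t by (auto simp: strongly_convex_on_def)
    finally have "t * (h z + (1 - t) * ?a) \<le> t * h v"
      by (simp add: norm_minus_commute algebra_simps)
    then show ?thesis using t by simp
  qed
  then have ev: "\<forall>\<^sub>F t in at_right 0. h z + (1 - t) * ?a \<le> h v"
    by (auto simp: eventually_at_right_field intro!: exI[of _ 1])
  have "((\<lambda>t. h z + (1 - t) * ?a) \<longlongrightarrow> h z + (1 - 0) * ?a) (at_right 0)"
    by (intro tendsto_intros)
  from tendsto_upperbound[OF this ev] show ?thesis by simp
qed

lemma strongly_convex_on_add:
  assumes "strongly_convex_on C \<mu> h" "strongly_convex_on C \<nu> k"
  shows "strongly_convex_on C (\<mu> + \<nu>) (\<lambda>v. h v + k v)"
  unfolding strongly_convex_on_def
proof (intro conjI ballI)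
  show "convex C" using assms by (simp add: strongly_convex_on_def)
  fix x y and t :: real assume A: "x \<in> C" "y \<in> C" "t \<in> {0..1}"
  have "h ((1 - t) *\<^sub>R x + t *\<^sub>R y)
          \<le> (1 - t) * h x + t * h y - \<mu> / 2 * t * (1 - t) * (norm (x - y))\<^sup>2"
    "k ((1 - t) *\<^sub>R x + t *\<^sub>R y)
          \<le> (1 - t) * k x + t * k y - \<nu> / 2 * t * (1 - t) * (norm (x - y))\<^sup>2"
    using assms A by (auto simp: strongly_convex_on_def)
  then show "h ((1 - t) *\<^sub>R x + t *\<^sub>R y) + k ((1 - t) *\<^sub>R x + t *\<^sub>R y)
      \<le> (1 - t) * (h x + k x) + t * (h y + k y)
        - (\<mu> + \<nu>) / 2 * t * (1 - t) * (norm (x - y))\<^sup>2"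
    by (simp add: algebra_simps add_divide_distrib)
qed

lemma strongly_convex_on_linear:
  assumes "convex C"
  shows "strongly_convex_on C 0 (\<lambda>v. a \<bullet> v)"
  using assms by (simp add: strongly_convex_on_def inner_add_right)

lemma strongly_convex_on_square:
  fixes p :: "'a::real_inner"
  assumes "convex C"
  shows "strongly_convex_on C \<mu> (\<lambda>v. \<mu> / 2 * (norm (v - p))\<^sup>2)"
  unfolding strongly_convex_on_def
proof (intro conjI ballI)
  fix x y :: 'a and t :: real
  have *: "(norm ((1 - t) *\<^sub>R x + t *\<^sub>R y - p))\<^sup>2
      = (1 - t) * (norm (x - p))\<^sup>2 + t * (norm (y - p))\<^sup>2 - t * (1 - t) * (norm (x - y))\<^sup>2"
    unfolding power2_norm_eq_inner
    by (simp add: inner_add_left inner_add_right inner_diff_left inner_diff_right inner_commute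
        algebra_simps)
  show "\<mu> / 2 * (norm ((1 - t) *\<^sub>R x + t *\<^sub>R y - p))\<^sup>2
      \<le> (1 - t) * (\<mu> / 2 * (norm (x - p))\<^sup>2) + t * (\<mu> / 2 * (norm (y - p))\<^sup>2)
        - \<mu> / 2 * t * (1 - t) * (norm (x - y))\<^sup>2"
    unfolding * by (simp add: algebra_simps add_divide_distrib diff_divide_distrib)
qed (fact assms)

lemma strongly_convex_subgradient_gap:
  assumes sc: "strongly_convex_on C \<mu> h" and sub: "s \<in> subdifferential_on C h z"
    and zC: "z \<in> C" and v: "v \<in> C"
  shows "h z + s \<bullet> (v - z) + \<mu> / 2 * (norm (v - z))\<^sup>2 \<le> h v"
proof -
  have C: "convex C" using sc by (simp add: strongly_convex_on_def)
  have "strongly_convex_on C (\<mu> + 0) (\<lambda>v. h v + (- s) \<bullet> v)"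
    by (intro strongly_convex_on_add sc strongly_convex_on_linear C)
  moreover have "is_arg_min (\<lambda>v. h v + (- s) \<bullet> v) (\<lambda>v. v \<in> C) z"
    using sub zC by (force simp: is_arg_min_linorder subdifferential_on_def inner_diff_right)
  ultimately have "h z + (- s) \<bullet> z + (\<mu> + 0) / 2 * (norm (v - z))\<^sup>2 \<le> h v + (- s) \<bullet> v"
    using v by (rule strongly_convex_minimizer_gap)
  then show ?thesis by (simp add: inner_diff_right)
qed

section \<open>The Lagrangian\<close>

lemma inner_nonneg_mono:
  fixes l a b :: "real^'m"
  assumes "0 \<le> l" "a \<le> b"
  shows "l \<bullet> a \<le> l \<bullet> b"
  unfolding inner_vec_def using assms by (auto simp: less_eq_vec_def intro!: sum_mono mult_left_mono)

lemma GDERIV_lagrangian: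
  fixes f :: "real^'n \<Rightarrow> real" and g :: "real^'n \<Rightarrow> real^'m"
  assumes "f differentiable (at v)" "g differentiable (at v)"
  shows "GDERIV (\<lambda>v. f v + l \<bullet> g v) v :> gradient f v + transpose (jacobian g (at v)) *v l"
proof -
  have "(g has_derivative (\<lambda>d. jacobian g (at v) *v d)) (at v)"
    using assms by (simp add: jacobian_works)
  then have "((\<lambda>v. l \<bullet> g v) has_derivative (\<lambda>d. l \<bullet> (jacobian g (at v) *v d))) (at v)"
    by (rule has_derivative_inner_right)
  then have "GDERIV (\<lambda>v. l \<bullet> g v) v :> transpose (jacobian g (at v)) *v l"
    by (simp add: gderiv_def inner_commute[of _ "_ v* _"] dot_lmul_matrix)
  then show ?thesis
    by (intro GDERIV_add GDERIV_gradient assms)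
qed

lemma convex_on_lagrangian:
  fixes g :: "real^'n \<Rightarrow> real^'m"
  assumes "convex_on UNIV f" "\<And>i. convex_on UNIV (\<lambda>v. g v $ i)" "0 \<le> l"
  shows "convex_on UNIV (\<lambda>v. f v + l \<bullet> g v)"
proof (intro convex_on_add assms(1) convex_onI)
  fix t :: real and v w :: "real^'n"
  assume t: "0 < t" "t < 1"
  have "g ((1 - t) *\<^sub>R v + t *\<^sub>R w) \<le> (1 - t) *\<^sub>R g v + t *\<^sub>R g w"
    using convex_onD[OF assms(2), of t v w] t by (simp add: less_eq_vec_def)
  from inner_nonneg_mono[OF assms(3) this]
  show "l \<bullet> g ((1 - t) *\<^sub>R v + t *\<^sub>R w) \<le> (1 - t) * (l \<bullet> g v) + t * (l \<bullet> g w)"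
    by (simp add: inner_add_right)
qed auto

lemma jacobian_component:
  fixes g :: "real^'n \<Rightarrow> real^'m"
  assumes "g differentiable (at v)"
  shows "(jacobian g (at v) *v d) $ i = gradient (\<lambda>x. g x $ i) v \<bullet> d"
    and "GDERIV (\<lambda>x. g x $ i) v :> gradient (\<lambda>x. g x $ i) v"
proof -
  have "GDERIV (\<lambda>x. 0 + axis i 1 \<bullet> g x) v
      :> gradient (\<lambda>x. 0) v + transpose (jacobian g (at v)) *v axis i 1"
    by (rule GDERIV_lagrangian) (use assms in auto)
  moreover have "gradient (\<lambda>x. 0) v = 0"
    by (intro gradient_eqI GDERIV_const)
  ultimately have G: "GDERIV (\<lambda>x. g x $ i) v :> transpose (jacobian g (at v)) *v axis i 1"
    by (simp add: inner_axis')
  show "(jacobian g (at v) *v d) $ i = gradient (\<lambda>x. g x $ i) v \<bullet> d"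
    unfolding gradient_eqI[OF G] by (simp add: dot_lmul_matrix inner_axis')
  show "GDERIV (\<lambda>x. g x $ i) v :> gradient (\<lambda>x. g x $ i) v"
    unfolding gradient_eqI[OF G] by (rule G)
qed

lemma convex_above_jacobian_tangent:
  fixes g :: "real^'n \<Rightarrow> real^'m"
  assumes "\<And>i. convex_on UNIV (\<lambda>v. g v $ i)" "g differentiable (at v)"
  shows "g v + jacobian g (at v) *v (w - v) \<le> g w"
  using convex_above_tangent[OF assms(1) jacobian_component(2)[OF assms(2)], of _ w]
  by (simp add: less_eq_vec_def jacobian_component(1)[OF assms(2)])

section \<open>One primal-dual step of the inner loop\<close>

lemma scaled_Young:
  fixes a b p q r m :: real
  assumes "(r * m)\<^sup>2 \<le> p * q" "p \<ge> 0" "q \<ge> 0" "a \<ge> 0" "b \<ge> 0"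
  shows "r * (m * a * b) \<le> p / 2 * a\<^sup>2 + q / 2 * b\<^sup>2"
proof -
  have "\<bar>r * m\<bar> \<le> sqrt p * sqrt q"
    using assms by (metis real_le_rsqrt power2_abs real_sqrt_mult)
  then have "r * m \<le> sqrt p * sqrt q" by linarith
  then have "(r * m) * (a * b) \<le> (sqrt p * sqrt q) * (a * b)"
    using assms by (intro mult_right_mono) auto
  moreover have "0 \<le> (sqrt p * a - sqrt q * b)\<^sup>2" by simp
  ultimately show ?thesis
    using assms by (simp add: power2_diff power_mult_distrib algebra_simps)
qed

lemma matrix_norm_bilinear_bound:
  "l \<bullet> (A *v v) \<le> matrix_norm A * norm l * norm v"
proof -
  have "l \<bullet> (A *v v) \<le> norm l * norm (A *v v)" by (rule norm_cauchy_schwarz)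
  also have "\<dots> \<le> norm l * (matrix_norm A * norm v)"
    unfolding matrix_norm_def
    by (intro mult_left_mono onorm) (auto simp: linear_linear)
  finally show ?thesis by (simp add: algebra_simps)
qed

text \<open>The state after an inner step is summarized by the distances of the iterates to the
  reference pair \<open>(xr, lr)\<close>, the extrapolation term still to be compensated, and the last dual
  increment, which pays for that compensation.\<close>

definition inner_potential ::
  "real \<Rightarrow> real^'n \<Rightarrow> real^'m \<Rightarrow> real \<Rightarrow> real \<Rightarrow> real^'n^'m \<Rightarrow> real^'m \<Rightarrow> real^'m \<Rightarrow> real^'n \<Rightarrow> real"
  where
  "inner_potential K xr lr b w A lp l y =
     K / 2 * (norm (lr - l))\<^sup>2 + b / 2 * (norm (xr - y))\<^sup>2
       - w * ((l - lp) \<bullet> (A *v (y - xr))) + K / 2 * (norm (l - lp))\<^sup>2"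

text \<open>By Young's inequality the two squares that do not involve \<open>lr\<close> absorb the cross term.\<close>

lemma inner_potential_nonneg:
  assumes "matrix_norm A \<le> m" "(w * m)\<^sup>2 \<le> K * b" "K \<ge> 0" "b \<ge> 0" "w \<ge> 0"
  shows "inner_potential K xr lr b w A lp l y \<ge> 0"
proof -
  have "w * ((l - lp) \<bullet> (A *v (y - xr))) \<le> w * (m * norm (l - lp) * norm (y - xr))"
    using assms matrix_norm_bilinear_bound[of "l - lp" A "y - xr"]
    by (intro mult_left_mono) (auto intro: order_trans intro!: mult_right_mono)
  also have "\<dots> \<le> K / 2 * (norm (l - lp))\<^sup>2 + b / 2 * (norm (y - xr))\<^sup>2"
    using assms by (intro scaled_Young) auto
  moreover have "0 \<le> K / 2 * (norm (lr - l))\<^sup>2" using assms by simp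
  ultimately show ?thesis
    unfolding inner_potential_def norm_minus_commute[of xr y] by linarith
qed

text \<open>One inner step. The proximal steps in \<open>y\<close> and \<open>l\<close> are three-point inequalities; what remains
  is the mismatch between the new multiplier and its extrapolation. That mismatch telescopes except
  for one cross term, which is split by Young's inequality between the primal increment
  \<open>y1 - y0\<close> of this step and the dual increment \<open>l0 - lp\<close> of the preceding one. The modulus
  \<open>\<alpha>\<close> is shared equally: one half increases the weight of \<open>y1\<close> in the potential, the
  other half is left for the outer iteration.\<close>

lemma inner_step:
  fixes A Ap :: "real^'n^'m"
  assumes X: "xr \<in> X" and u: "strongly_convex_on X \<alpha> u" and lr: "0 \<le> lr"
    and y1: "is_arg_min (\<lambda>v. (transpose A *v l0 + r *\<^sub>R (transpose Ap *v (l0 - lp)) + p) \<bullet> v + u v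
        + e / 2 * (norm (v - xc))\<^sup>2 + \<beta> / 2 * (norm (v - y0))\<^sup>2) (\<lambda>v. v \<in> X) y1"
    and l1: "is_arg_max (\<lambda>l. l \<bullet> (A *v (y1 - z) + gz) - \<gamma> / 2 * (norm (l - l0))\<^sup>2) (\<lambda>l. 0 \<le> l) l1"
    and w: "w \<ge> 0" "\<alpha> \<ge> 0" "wp \<ge> 0" "\<beta> \<ge> 0" "K \<ge> 0"
    and K: "w * \<gamma> = K" and r: "(w * r) *\<^sub>R (l0 - lp) = wp *\<^sub>R (l0 - lp)"
    and m: "matrix_norm Ap \<le> m" "(wp * m)\<^sup>2 \<le> K * (w * \<beta>)" and b: "w * \<beta> \<le> b"
  shows "w * (p \<bullet> (y1 - xr) + lr \<bullet> (gz + A *v (y1 - z)) - l1 \<bullet> (gz + A *v (xr - z)) + u y1 - u xr)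
      \<le> inner_potential K xr lr b wp Ap lp l0 y0
        - inner_potential K xr lr (w * (\<alpha> / 2 + \<beta>)) w A l0 l1 y1
        + w * (e / 2 * (norm (xr - xc))\<^sup>2 - e / 2 * (norm (y1 - xc))\<^sup>2
               - (e + \<alpha> / 2) / 2 * (norm (xr - y1))\<^sup>2)"
proof -
  let ?h = "transpose A *v l0 + r *\<^sub>R (transpose Ap *v (l0 - lp)) + p"
  have cX: "convex X" using u by (simp add: strongly_convex_on_def)
  have "strongly_convex_on X (0 + \<alpha> + e + \<beta>) (\<lambda>v. ?h \<bullet> v + u v
        + e / 2 * (norm (v - xc))\<^sup>2 + \<beta> / 2 * (norm (v - y0))\<^sup>2)"
    by (intro strongly_convex_on_add strongly_convex_on_linear strongly_convex_on_square u cX)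
  from strongly_convex_minimizer_gap[OF this y1 X]
  have P: "?h \<bullet> (y1 - xr) + u y1 - u xr
      \<le> e / 2 * (norm (xr - xc))\<^sup>2 - e / 2 * (norm (y1 - xc))\<^sup>2 + \<beta> / 2 * (norm (xr - y0))\<^sup>2
        - \<beta> / 2 * (norm (y1 - y0))\<^sup>2 - (\<alpha> + e + \<beta>) / 2 * (norm (xr - y1))\<^sup>2"
    by (simp add: inner_diff_right del: transpose_matrix_vector)
  have cL: "convex {l :: real^'m. 0 \<le> l}"
    by (auto simp: convex_def less_eq_vec_def)
  let ?q = "A *v (y1 - z) + gz"
  have "strongly_convex_on {l. 0 \<le> l} (0 + \<gamma>) (\<lambda>l. (- ?q) \<bullet> l + \<gamma> / 2 * (norm (l - l0))\<^sup>2)"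
    by (intro strongly_convex_on_add strongly_convex_on_linear strongly_convex_on_square cL)
  moreover have "is_arg_min (\<lambda>l. (- ?q) \<bullet> l + \<gamma> / 2 * (norm (l - l0))\<^sup>2) (\<lambda>l. l \<in> {l. 0 \<le> l}) l1"
    using l1 by (auto simp: is_arg_min_linorder is_arg_max_linorder inner_commute algebra_simps)
  ultimately have "(- ?q) \<bullet> l1 + \<gamma> / 2 * (norm (l1 - l0))\<^sup>2 + (0 + \<gamma>) / 2 * (norm (lr - l1))\<^sup>2
      \<le> (- ?q) \<bullet> lr + \<gamma> / 2 * (norm (lr - l0))\<^sup>2"
    using lr by (intro strongly_convex_minimizer_gap) auto
  then have D: "(lr - l1) \<bullet> ?q \<le> \<gamma> / 2 * (norm (lr - l0))\<^sup>2 - \<gamma> / 2 * (norm (l1 - l0))\<^sup>2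
      - \<gamma> / 2 * (norm (lr - l1))\<^sup>2"
    by (simp add: inner_diff_left inner_commute algebra_simps)
  have "?h \<bullet> (y1 - xr) = l0 \<bullet> (A *v (y1 - xr)) + r * ((l0 - lp) \<bullet> (Ap *v (y1 - xr))) + p \<bullet> (y1 - xr)"
    by (simp add: inner_add_left dot_lmul_matrix)
  moreover have "A *v (y1 - z) = A *v (y1 - xr) + A *v (xr - z)"
    by (simp add: matrix_vector_right_distrib[symmetric])
  ultimately have G: "p \<bullet> (y1 - xr) + lr \<bullet> (gz + A *v (y1 - z)) - l1 \<bullet> (gz + A *v (xr - z)) + u y1 - u xr
     = (?h \<bullet> (y1 - xr) + u y1 - u xr) + (lr - l1) \<bullet> ?q
       + (l1 - l0) \<bullet> (A *v (y1 - xr)) - r * ((l0 - lp) \<bullet> (Ap *v (y1 - xr)))"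
    by (simp add: inner_diff_left inner_add_right algebra_simps)
  have "w * r * ((l0 - lp) \<bullet> (Ap *v (y1 - xr))) = ((w * r) *\<^sub>R (l0 - lp)) \<bullet> (Ap *v (y1 - xr))"
    by simp
  also have "\<dots> = wp * ((l0 - lp) \<bullet> (Ap *v (y1 - xr)))"
    unfolding r by simp
  also have "\<dots> = wp * ((l0 - lp) \<bullet> (Ap *v (y0 - xr))) - wp * ((l0 - lp) \<bullet> (Ap *v (y0 - y1)))"
    by (simp add: matrix_vector_mult_diff_distrib inner_diff_right algebra_simps)
  finally have E: "w * (r * ((l0 - lp) \<bullet> (Ap *v (y1 - xr))))
      = wp * ((l0 - lp) \<bullet> (Ap *v (y0 - xr))) - wp * ((l0 - lp) \<bullet> (Ap *v (y0 - y1)))"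
    by (simp add: algebra_simps)
  have "wp * ((l0 - lp) \<bullet> (Ap *v (y0 - y1))) \<le> wp * (m * norm (l0 - lp) * norm (y0 - y1))"
    using w m(1) matrix_norm_bilinear_bound[of "l0 - lp" Ap "y0 - y1"]
    by (intro mult_left_mono) (auto intro: order_trans intro!: mult_right_mono)
  also have "\<dots> \<le> K / 2 * (norm (l0 - lp))\<^sup>2 + (w * \<beta>) / 2 * (norm (y0 - y1))\<^sup>2"
    using w m by (intro scaled_Young) auto
  finally have C: "wp * ((l0 - lp) \<bullet> (Ap *v (y0 - y1)))
      \<le> K / 2 * (norm (l0 - lp))\<^sup>2 + (w * \<beta>) / 2 * (norm (y1 - y0))\<^sup>2"
    by (simp add: norm_minus_commute)
  have B: "(w * \<beta>) / 2 * (norm (xr - y0))\<^sup>2 \<le> b / 2 * (norm (xr - y0))\<^sup>2"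
    using b by (intro mult_right_mono) auto
  have P': "w * (?h \<bullet> (y1 - xr) + u y1 - u xr)
      \<le> w * (e / 2 * (norm (xr - xc))\<^sup>2 - e / 2 * (norm (y1 - xc))\<^sup>2 + \<beta> / 2 * (norm (xr - y0))\<^sup>2
        - \<beta> / 2 * (norm (y1 - y0))\<^sup>2 - (\<alpha> + e + \<beta>) / 2 * (norm (xr - y1))\<^sup>2)"
    using P w by (intro mult_left_mono) auto
  have "w * ((lr - l1) \<bullet> ?q) \<le> w * (\<gamma> / 2 * (norm (lr - l0))\<^sup>2 - \<gamma> / 2 * (norm (l1 - l0))\<^sup>2
      - \<gamma> / 2 * (norm (lr - l1))\<^sup>2)"
    using D w by (intro mult_left_mono) auto
  also have "\<dots> = K / 2 * (norm (lr - l0))\<^sup>2 - K / 2 * (norm (l1 - l0))\<^sup>2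
      - K / 2 * (norm (lr - l1))\<^sup>2"
    unfolding K[symmetric] by (simp add: algebra_simps)
  finally have D': "w * ((lr - l1) \<bullet> ?q) \<le> K / 2 * (norm (lr - l0))\<^sup>2 - K / 2 * (norm (l1 - l0))\<^sup>2
      - K / 2 * (norm (lr - l1))\<^sup>2" .
  have R: "w * (e / 2 * (norm (xr - xc))\<^sup>2 - e / 2 * (norm (y1 - xc))\<^sup>2 + \<beta> / 2 * (norm (xr - y0))\<^sup>2
        - \<beta> / 2 * (norm (y1 - y0))\<^sup>2 - (\<alpha> + e + \<beta>) / 2 * (norm (xr - y1))\<^sup>2)
     = w * (e / 2 * (norm (xr - xc))\<^sup>2 - e / 2 * (norm (y1 - xc))\<^sup>2
               - (e + \<alpha> / 2) / 2 * (norm (xr - y1))\<^sup>2)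
       + w * \<beta> / 2 * (norm (xr - y0))\<^sup>2 - w * \<beta> / 2 * (norm (y1 - y0))\<^sup>2
       - w * (\<alpha> / 2 + \<beta>) / 2 * (norm (xr - y1))\<^sup>2"
    by (simp add: field_simps)
  have G': "w * (p \<bullet> (y1 - xr) + lr \<bullet> (gz + A *v (y1 - z)) - l1 \<bullet> (gz + A *v (xr - z)) + u y1 - u xr)
     = w * (?h \<bullet> (y1 - xr) + u y1 - u xr) + w * ((lr - l1) \<bullet> ?q)
       + w * ((l1 - l0) \<bullet> (A *v (y1 - xr))) - w * (r * ((l0 - lp) \<bullet> (Ap *v (y1 - xr))))"
    unfolding G by (simp only: distrib_left right_diff_distrib)
  show ?thesis
    using P' D' C B unfolding G' E R inner_potential_def by argo
qed

section \<open>Stepsizes of the outer loop\<close>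

lemma tau_1 [simp]: "\<kappa> \<ge> 0 \<Longrightarrow> tau \<kappa> (Suc 0) = 0"
  by (simp add: tau_def)

lemma tau_nonneg: "\<kappa> \<ge> 0 \<Longrightarrow> t \<ge> 1 \<Longrightarrow> tau \<kappa> t \<ge> 0"
  by (simp add: tau_def)

lemma tau_pos: "\<kappa> > 0 \<Longrightarrow> t \<ge> 2 \<Longrightarrow> tau \<kappa> t > 0"
  by (simp add: tau_def)

lemma tau_Suc_le: "tau \<kappa> (Suc t) \<le> tau \<kappa> t + 1"
  by (auto simp: tau_def min_def field_simps)

lemma omega_mult_tau:
  assumes "\<kappa> > 0" "t \<ge> 1"
  shows "omega \<kappa> (Suc t) * tau \<kappa> (Suc t) = omega \<kappa> t * (tau \<kappa> t + 1)"
proof -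
  obtain k where "t = Suc k" using assms by (cases t) auto
  moreover have "tau \<kappa> (Suc t) > 0" "tau \<kappa> t + 1 > 0"
    using assms tau_pos[of \<kappa> "Suc t"] tau_nonneg[of \<kappa> t] by auto
  ultimately show ?thesis by (simp add: theta_def)
qed

lemma theta_nonneg: "\<kappa> \<ge> 0 \<Longrightarrow> t \<ge> 1 \<Longrightarrow> theta \<kappa> t \<ge> 0"
  using tau_nonneg[of \<kappa> t] tau_nonneg[of \<kappa> "t - 1"]
  by (cases "t = 1") (auto simp: theta_def)

lemma theta_le_1:
  assumes "\<kappa> \<ge> 0" "t \<ge> 1"
  shows "theta \<kappa> t \<le> 1"
proof (cases "t = 1")
  case False
  then obtain k where "t = Suc k" "k \<ge> 1" using assms by (cases t) auto
  then show ?thesis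
    using tau_nonneg[of \<kappa> k] tau_Suc_le[of \<kappa> k] assms by (simp add: theta_def)
qed (use assms in \<open>simp add: theta_def\<close>)

lemma omega_ge:
  assumes "\<kappa> > 0"
  shows "t \<ge> 1 \<Longrightarrow> omega \<kappa> t \<ge> real t"
proof (induction t rule: dec_induct)
  case (step t)
  let ?a = "tau \<kappa> (Suc t)"
  have a: "?a > 0" using tau_pos[of \<kappa> "Suc t"] assms step by auto
  have "?a * (real t + 1) \<le> real t * (tau \<kappa> t + 1)"
  proof -
    have "?a \<le> real t / 2" "?a \<le> sqrt (2 * \<kappa>)" by (auto simp: tau_def)
    then have "?a * (real t + 1) \<le> real t / 2 * (real t + 1)" "?a \<le> real t"
      using a by (auto intro!: mult_right_mono)
    moreover have "?a * (real t + 1) \<le> real t * (sqrt (2 * \<kappa>) + 1)"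
    proof -
      have "?a * real t \<le> sqrt (2 * \<kappa>) * real t"
        using \<open>?a \<le> sqrt (2 * \<kappa>)\<close> by (intro mult_right_mono) auto
      then show ?thesis using \<open>?a \<le> real t\<close> by (simp add: algebra_simps)
    qed
    ultimately show ?thesis
      by (auto simp: tau_def[of \<kappa> t] min_def field_simps)
  qed
  also have "\<dots> \<le> omega \<kappa> t * (tau \<kappa> t + 1)"
    using step tau_nonneg[of \<kappa> t] assms by (intro mult_right_mono) auto
  also have "\<dots> = omega \<kappa> (Suc t) * ?a"
    using omega_mult_tau[OF assms, of t] step by simp
  finally show ?case
    using a by (simp add: mult.commute add.commute)
qed simp

lemma omega_ge_1: "\<kappa> > 0 \<Longrightarrow> t \<ge> 1 \<Longrightarrow> omega \<kappa> t \<ge> 1"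
  using omega_ge[of \<kappa> t] by linarith

lemma omega_mult_theta:
  assumes "\<kappa> > 0" "t \<ge> 1"
  shows "omega \<kappa> (Suc t) * theta \<kappa> (Suc t) = omega \<kappa> t"
  using omega_mult_tau[OF assms] tau_nonneg[of \<kappa> t] assms
  by (simp add: theta_def field_simps)

lemma sum_omega:
  assumes "\<kappa> > 0"
  shows "N \<ge> 1 \<Longrightarrow> (\<Sum>t=1..N. omega \<kappa> t) = omega \<kappa> N * (tau \<kappa> N + 1)"
proof (induction N rule: dec_induct)
  case (step N)
  then show ?case
    using omega_mult_tau[OF assms, of N] by (simp add: algebra_simps)
qed (use assms in simp)

text \<open>This is what lets half of the strong convexity compensate the growth of
  \<open>omega t * eta t\<close> once \<open>tau\<close> has reached its cap \<open>sqrt (2 \<kappa>)\<close>.\<close>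

lemma omega_mult_eta_le:
  assumes \<alpha>: "\<alpha> > 0" and \<kappa>: "Lc / \<alpha> \<ge> 1" and t: "t \<ge> 1"
  shows "omega (Lc/\<alpha>) (Suc t) * eta Lc (Lc/\<alpha>) (Suc t)
    \<le> omega (Lc/\<alpha>) t * (eta Lc (Lc/\<alpha>) t + \<alpha> / 2)"
proof -
  define k where "k = Lc / \<alpha>"
  define T where "T = sqrt (2 * k)"
  let ?a = "tau k t" and ?b = "tau k (Suc t)" and ?c = "tau k (Suc (Suc t))"
  have k: "k \<ge> 1" and Lc: "Lc = k * \<alpha>" using \<alpha> \<kappa> by (auto simp: k_def)
  have pos: "?a \<ge> 0" "?b > 0" "?c > 0"
    using tau_nonneg[of k t] tau_pos[of k "Suc t"] tau_pos[of k "Suc (Suc t)"] k t by auto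
  have T: "T\<^sup>2 = 2 * k" "T > 0" using k by (auto simp: T_def)
  have key: "(?a + 1) * T\<^sup>2 \<le> ?c * (T\<^sup>2 + ?b)"
  proof (cases "real t + 1 \<le> 2 * T")
    case True
    then have "?c = (real t + 1) / 2" "?a = (real t - 1) / 2"
      by (auto simp: tau_def T_def)
    then have "?a + 1 = ?c" by simp
    then show ?thesis using pos by (simp add: distrib_left)
  next
    case False
    then have c: "?c = T" by (simp add: tau_def T_def)
    show ?thesis
    proof (cases "real t \<le> 2 * T")
      case True
      then have ab: "?b = real t / 2" "?a = (real t - 1) / 2" by (auto simp: tau_def T_def)
      have "(real t + 1) / 2 * T \<le> T * T + real t / 2"
      proof -
        \<comment> \<open>The right side exceeds the left side by this product plus \<open>real t / 4\<close>.\<close>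
        have "0 \<le> (T - real t / 2) * (T - 1/2)"
          using True False t by (cases "t = 1") (auto intro!: mult_nonneg_nonneg)
        then show ?thesis using t by (simp add: field_simps)
      qed
      then have "T * ((real t + 1) / 2 * T) \<le> T * (T * T + real t / 2)"
        using T by (intro mult_left_mono) auto
      then show ?thesis unfolding c ab by (simp add: power2_eq_square field_simps)
    next
      case False
      then have "?b = T" by (simp add: tau_def T_def)
      moreover have "?a \<le> T" by (simp add: tau_def T_def)
      then have "?a * T\<^sup>2 \<le> T * T\<^sup>2" by (intro mult_right_mono) auto
      ultimately show ?thesis unfolding c by (simp add: power2_eq_square algebra_simps)
    qed
  qed
  have "(?a + 1) / ?c \<le> 1 + ?b / (2 * k)"
    using key pos k unfolding T by (simp add: field_simps)
  then have "omega k t * Lc / ?b * ((?a + 1) / ?c) \<le> omega k t * Lc / ?b * (1 + ?b / (2 * k))"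
    using pos omega_ge_1[of k t] k t \<alpha> Lc by (intro mult_left_mono) auto
  moreover have om: "omega k (Suc t) = omega k t * (?a + 1) / ?b"
    using omega_mult_tau[of k t] k t pos by (simp add: field_simps)
  have "omega k (Suc t) * (Lc / ?c) = omega k t * Lc / ?b * ((?a + 1) / ?c)"
    unfolding om by simp
  moreover have "omega k t * Lc / ?b * (1 + ?b / (2 * k)) = omega k t * (Lc / ?b + \<alpha> / 2)"
    using pos k unfolding Lc by (simp add: field_simps)
  ultimately show ?thesis
    unfolding k_def[symmetric] eta_def by simp
qed

text \<open>Let \<open>T = sqrt (2 \<kappa>)\<close> and \<open>q = 1 + 1 / T\<close>. Up to the index \<open>2 T + 1\<close> the quadratic lower bound is
  compared with the exponential, whose growth \<open>q\<^sup>n \<le> exp (n / T)\<close> does not exceed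
  \<open>exp 2 \<le> 9\<close> there. Every later weight multiplies the sum by \<open>q\<close>, so an inequality without the
  summand \<open>- T\<close> must be reached at the transition; there the sum is at least \<open>T (2 T + 1)\<close>, and the
  factor \<open>q\<^sup>3\<close> between the powers \<open>N - 1\<close> and \<open>N - 4\<close> makes \<open>9 \<le> (2 T + 1) q\<^sup>3\<close> sufficient.\<close>

lemma sum_omega_ge:
  assumes \<kappa>: "\<kappa> \<ge> 1" and N: "N \<ge> 1"
  shows "(\<Sum>t=1..N. omega \<kappa> t) \<ge> max (real N * (real N + 1) / 2)
    (sqrt (2 * \<kappa>) * ((1 + 1 / sqrt (2 * \<kappa>)) powi (int N - 4) - 1))"
proof -
  let ?W = "\<lambda>N. \<Sum>t=1..N. omega \<kappa> t"
  define T where "T = sqrt (2 * \<kappa>)"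
  define q where "q = 1 + 1 / T"
  have T: "T \<ge> 1" using \<kappa> by (simp add: T_def)
  have q: "q > 1" using T by (simp add: q_def)
  have quad: "real n * (real n + 1) / 2 \<le> ?W n" for n
  proof (induction n)
    case (Suc n)
    have "real (Suc n) \<le> omega \<kappa> (Suc n)" using omega_ge[of \<kappa> "Suc n"] \<kappa> by simp
    then show ?case using Suc by (simp add: field_simps)
  qed simp
  have exp2: "exp (2::real) \<le> 9"
  proof -
    have "exp (2::real) = exp 1 * exp 1" by (simp flip: exp_add)
    also have "\<dots> \<le> 3 * 3" using exp_le by (intro mult_mono) auto
    finally show ?thesis by simp
  qed
  have q_pow: "q ^ n \<le> exp (real n / T)" for n
  proof -
    have "q \<le> exp (1 / T)" unfolding q_def by (rule exp_ge_add_one_self)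
    then have "q ^ n \<le> exp (1 / T) ^ n" using q by (intro power_mono) auto
    then show ?thesis by (simp flip: exp_of_nat_mult)
  qed
  have exp_chord: "exp a \<le> 1 + 4 * a" if a: "0 \<le> a" "a \<le> (2::real)" for a
  proof -
    have "exp ((1 - a / 2) *\<^sub>R 0 + (a / 2) *\<^sub>R 2) \<le> (1 - a / 2) * exp 0 + a / 2 * exp (2::real)"
      using a convex_onD[OF exp_convex, of "a / 2" 0 2] by simp
    also have "\<dots> \<le> (1 - a / 2) * 1 + a / 2 * 9"
      using a exp2 by (intro add_mono mult_left_mono) auto
    finally show ?thesis by simp
  qed
  let ?P = "\<lambda>n. ?W n + T \<ge> T * q powi (int n - 4) \<and>
      (2 * T < real n \<longrightarrow> ?W n \<ge> T * q powi (int n - 4))"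
  have start: "?P n" if "n \<ge> 1" and n_le: "real n - 1 \<le> 2 * T" for n
  proof -
    have small: "?W n + T \<ge> T * q powi (int n - 4)"
    proof (cases "n \<le> 4")
      case True
      have "q powi (int n - 4) \<le> 1"
      proof -
        have "q powi (int n - 4) = inverse (q ^ (4 - n))"
          using True by (simp add: power_int_def nat_diff_distrib of_nat_diff power_inverse)
        then show ?thesis using q by (simp add: inverse_le_1_iff one_le_power)
      qed
      then have "T * q powi (int n - 4) \<le> T * 1" using T by (intro mult_left_mono) auto
      moreover have "0 \<le> ?W n" using quad[of n] by (smt (verit) divide_nonneg_nonneg mult_nonneg_nonneg of_nat_0_le_iff)
      ultimately show ?thesis by simp
    next
      case False
      then have "q powi (int n - 4) = q ^ (n - 4)"
        by (simp add: power_int_def nat_diff_distrib)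
      also have "\<dots> \<le> 1 + 4 * (real (n - 4) / T)"
        using T n_le False by (intro order_trans[OF q_pow] exp_chord) (auto simp: field_simps)
      finally have "T * q powi (int n - 4) \<le> T * (1 + 4 * (real (n - 4) / T))"
        using T by (intro mult_left_mono) auto
      also have "\<dots> = T + 4 * (real n - 4)" using T False by (simp add: field_simps of_nat_diff)
      also have "4 * (real n - 4) \<le> real n * (real n + 1) / 2"
        using zero_le_power2[of "real n - 7/2"] by (simp add: power2_eq_square algebra_simps)
      finally show ?thesis using quad[of n] by linarith
    qed
    moreover have "?W n \<ge> T * q powi (int n - 4)" if n: "2 * T < real n"
    proof -
      have "q powi (int n - 4) = q powi (int (n - 1) + (-3))" using \<open>n \<ge> 1\<close> by (simp add: of_nat_diff)
      also have "\<dots> = q ^ (n - 1) / q ^ 3"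
        using q by (subst power_int_add) (auto simp: power_int_def field_simps)
      also have "\<dots> \<le> 9 / q ^ 3"
      proof (intro divide_right_mono)
        have "q ^ (n - 1) \<le> exp (real (n - 1) / T)" by (rule q_pow)
        also have "\<dots> \<le> exp 2" using n_le T \<open>n \<ge> 1\<close> by (simp add: field_simps of_nat_diff)
        finally show "q ^ (n - 1) \<le> 9" using exp2 by linarith
      qed (use q in auto)
      also have "\<dots> \<le> 2 * T + 1"
      proof -
        have "1 + 3 / T \<le> q ^ 3"
          using Bernoulli_inequality[of "1 / T" 3] T order_trans[of "-1" 0 "1 / T"]
          by (simp add: q_def)
        then have "(2 * T + 1) * (1 + 3 / T) \<le> (2 * T + 1) * q ^ 3"
          using T by (intro mult_left_mono) auto
        moreover have "(2 * T + 1) * (1 + 3 / T) = 2 * T + 7 + 3 / T"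
          using T by (simp add: field_simps)
        moreover have "3 / T \<ge> 0" using T by simp
        ultimately have "9 \<le> (2 * T + 1) * q ^ 3" using T by linarith
        then show ?thesis using q by (simp add: field_simps)
      qed
      finally have "T * q powi (int n - 4) \<le> T * (2 * T + 1)"
        using T by (intro mult_left_mono) auto
      also have "\<dots> = (2 * T) * (2 * T + 1) / 2" by simp
      also have "\<dots> \<le> real n * (real n + 1) / 2"
        using n T by (intro divide_right_mono mult_mono) auto
      finally show ?thesis using quad[of n] by linarith
    qed
    ultimately show ?thesis by blast
  qed
  have bounds: "?P n" if "n \<ge> 1" for n
    using that
  proof (induction n rule: dec_induct)
    case base
    show ?case using T by (intro start) auto
  next
    case (step n)
    show ?case
    proof (cases "real n \<le> 2 * T")
      case True
      then show ?thesis by (intro start) auto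
    next
      case False
      then have tau: "tau \<kappa> (Suc n) = T" by (simp add: tau_def T_def)
      have "omega \<kappa> (Suc n) * T = ?W n"
        using omega_mult_tau[of \<kappa> n] sum_omega[of \<kappa> n] step \<kappa> tau by simp
      then have W: "?W (Suc n) = ?W n * q"
        using T by (simp add: q_def field_simps)
      have "T * q powi (int n - 4) * q \<le> ?W n * q"
        using q step False by (intro mult_right_mono) auto
      moreover have "q powi (int (Suc n) - 4) = q powi (int n - 4) * q"
        using q power_int_add_1[of q "int n - 4"] by (simp add: algebra_simps)
      ultimately have "T * q powi (int (Suc n) - 4) \<le> ?W (Suc n)" unfolding W by (simp add: mult.assoc)
      then show ?thesis using T by linarith
    qed
  qed
  have "T * q powi (int N - 4) - T \<le> ?W N"
    using bounds[OF N] by linarith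
  then show ?thesis
    using quad[of N] by (simp add: T_def q_def algebra_simps)
qed

section \<open>Stepsizes of the inner loops\<close>

lemma partial_sum_unbounded:
  fixes a b :: real
  assumes "a > 0"
  shows "\<exists>n\<ge>1. b \<le> (\<Sum>s=1..n. a + (real s - 1))"
proof -
  obtain k :: nat where k: "b / a < real k" using reals_Archimedean2 by blast
  let ?n = "Suc k"
  have "b \<le> real ?n * a" using k assms by (simp add: field_simps)
  also have "\<dots> = (\<Sum>s=1..?n. a)" by simp
  also have "\<dots> \<le> (\<Sum>s=1..?n. a + (real s - 1))" by (intro sum_mono) auto
  finally show ?thesis by (intro exI[of _ ?n]) auto
qed

locale inner_stepsizes =
  fixes \<alpha> \<kappa> \<Delta> :: real and N :: nat and M \<Gamma> W :: "nat \<Rightarrow> real" and S :: "nat \<Rightarrow> nat"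
  assumes \<alpha>: "\<alpha> > 0" and \<kappa>: "\<kappa> \<ge> 1" and \<Delta>: "\<Delta> > 0" and N: "N \<ge> 1"
    and M: "\<And>t. M t > 0"
    and params: "inner_params \<kappa> \<Delta> N M S \<Gamma> W"
begin

abbreviation "\<delta> \<equiv> delta M \<Gamma> W"
abbreviation "\<beta> \<equiv> beta \<alpha> M \<Gamma> W"
abbreviation "\<gamma> \<equiv> gamma \<alpha> M \<Gamma> W"
abbreviation "w \<equiv> weight \<kappa> M \<Gamma> W S"
abbreviation "\<rho> \<equiv> rho \<kappa> M \<Gamma> W S"

lemma omega_pos: "t \<ge> 1 \<Longrightarrow> omega \<kappa> t > 0"
  using omega_ge_1[of \<kappa> t] \<kappa> by auto

lemma first_phase:
  shows S_1: "S 1 \<ge> 1" and \<Gamma>_1: "\<Gamma> 1 \<ge> 1"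
proof -
  let ?c = "omega \<kappa> 1 * (M 1)\<^sup>2 * \<Delta>"
  have S: "S 1 = (LEAST n. n \<ge> 1 \<and> (\<Sum>s=1..n. real s) \<ge> ?c)" and \<Gamma>: "\<Gamma> 1 \<ge> 0"
    and eq: "(\<Sum>s=1..S 1. real s) = (\<Gamma> 1)\<^sup>2 * omega \<kappa> 1 * (M 1)\<^sup>2 * \<Delta>"
    using params by (auto simp: inner_params_def)
  have c: "?c > 0" using omega_pos[of 1] M[of 1] \<Delta> by simp
  have "\<exists>n. n \<ge> 1 \<and> (\<Sum>s=1..n. real s) \<ge> ?c"
    using partial_sum_unbounded[of 1 ?c] by simp
  from LeastI_ex[OF this, folded S]
  have *: "S 1 \<ge> 1" "(\<Sum>s=1..S 1. real s) \<ge> ?c" by blast+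
  show "S 1 \<ge> 1" by fact
  have "1 * ?c \<le> (\<Gamma> 1)\<^sup>2 * ?c" using * eq by (simp add: mult.assoc)
  then have "1\<^sup>2 \<le> (\<Gamma> 1)\<^sup>2" using c by (subst (asm) mult_le_cancel_right) auto
  then show "\<Gamma> 1 \<ge> 1" using \<Gamma> by (rule power2_le_imp_le)
qed

text \<open>The number of inner steps is large enough for the left side of the equation for \<open>\<Gamma> t\<close> to
  reach the right side at the value \<open>1\<close>. As the left side grows only linearly and the right side
  quadratically, the positive root cannot lie below \<open>1\<close>.\<close>

lemma later_phase:
  assumes t: "2 \<le> t" "t \<le> N" and W: "W t > 0"
  shows "S t \<ge> 1" and "\<Gamma> t \<ge> 1"
proof -
  let ?c = "omega \<kappa> t * (M t)\<^sup>2 * \<Delta>" and ?a = "W t * M t"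
  have S: "S t = (LEAST n. n \<ge> 1 \<and> (\<Sum>s=1..n. ?a + (real s - 1)) \<ge> ?c)" and \<Gamma>: "\<Gamma> t > 0"
    and eq: "(\<Sum>s=1..S t. \<Gamma> t * W t * M t + (real s - 1)) = (\<Gamma> t)\<^sup>2 * omega \<kappa> t * (M t)\<^sup>2 * \<Delta>"
    using params t unfolding inner_params_def Ball_def atLeastAtMost_iff by blast+
  have c: "?c > 0" using omega_pos[of t] M[of t] \<Delta> t by simp
  have a: "?a > 0" using W M[of t] by simp
  have "\<exists>n. n \<ge> 1 \<and> (\<Sum>s=1..n. ?a + (real s - 1)) \<ge> ?c"
    using partial_sum_unbounded[OF a, of ?c] by simp
  from LeastI_ex[OF this, folded S]
  have *: "S t \<ge> 1" "(\<Sum>s=1..S t. ?a + (real s - 1)) \<ge> ?c" by blast+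
  show "S t \<ge> 1" by fact
  define A where "A = real (S t) * ?a"
  define B where "B = (\<Sum>s=1..S t. real s - 1)"
  have A: "A > 0" using a * by (simp add: A_def)
  have B: "B \<ge> 0" unfolding B_def by (intro sum_nonneg) auto
  have AB: "?c \<le> A + B" using * by (simp add: A_def B_def sum.distrib)
  have eq': "\<Gamma> t * A + B = (\<Gamma> t)\<^sup>2 * ?c"
    using eq by (simp add: A_def B_def sum.distrib mult_ac)
  show "\<Gamma> t \<ge> 1"
  proof (rule ccontr)
    assume "\<not> \<Gamma> t \<ge> 1"
    then have less: "(\<Gamma> t)\<^sup>2 < \<Gamma> t" "(\<Gamma> t)\<^sup>2 \<le> 1"
      using \<Gamma> by (auto simp: power2_eq_square mult_le_one)
    have "(\<Gamma> t)\<^sup>2 * ?c \<le> (\<Gamma> t)\<^sup>2 * (A + B)" using AB by (intro mult_left_mono) auto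
    also have "\<dots> = (\<Gamma> t)\<^sup>2 * A + (\<Gamma> t)\<^sup>2 * B" by (simp add: distrib_left)
    also have "\<dots> < \<Gamma> t * A + 1 * B"
      using less A B by (intro add_less_le_mono mult_strict_right_mono mult_right_mono) auto
    finally show False using eq' by simp
  qed
qed

lemma W_pos: "2 \<le> t \<Longrightarrow> t \<le> Suc N \<Longrightarrow> W t > 0"
proof (induction t rule: dec_induct)
  case base
  have "W (1 + 1) = \<delta> 1 (S 1) / M 1" using params N by (auto simp: inner_params_def)
  then show ?case using first_phase M[of 1] by (simp add: delta_def numeral_2_eq_2)
next
  case (step t)
  have "W (t + 1) = \<delta> t (S t) / M t" using params step by (auto simp: inner_params_def)
  moreover have "S t \<ge> 1" "\<Gamma> t \<ge> 1" using step later_phase[of t] by auto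
  ultimately show ?case using step M[of t] by (auto simp: delta_def intro!: divide_pos_pos add_pos_nonneg)
qed

lemma S_ge_1: "1 \<le> t \<Longrightarrow> t \<le> N \<Longrightarrow> S t \<ge> 1"
  using first_phase later_phase[of t] W_pos[of t] by (cases "t = 1") auto

lemma \<Gamma>_ge_1: "1 \<le> t \<Longrightarrow> t \<le> N \<Longrightarrow> \<Gamma> t \<ge> 1"
  using first_phase later_phase[of t] W_pos[of t] by (cases "t = 1") auto

lemma delta_pos: "1 \<le> t \<Longrightarrow> t \<le> N \<Longrightarrow> 1 \<le> s \<Longrightarrow> \<delta> t s > 0"
  using \<Gamma>_ge_1[of t] W_pos[of t] M[of t]
  by (auto simp: delta_def intro!: add_pos_nonneg)

text \<open>Divided by \<open>\<Gamma> t\<close>, the equation that determines \<open>\<Gamma> t\<close> evaluates the normalizing constant of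
  the weights.\<close>

lemma sum_delta:
  assumes t: "1 \<le> t" "t \<le> N"
  shows "(\<Sum>s=1..S t. \<delta> t s) = \<Gamma> t * omega \<kappa> t * (M t)\<^sup>2 * \<Delta>"
proof -
  have \<Gamma>: "\<Gamma> t > 0" using \<Gamma>_ge_1[OF t] by linarith
  have "\<Gamma> t * (\<Sum>s=1..S t. \<delta> t s) = (\<Gamma> t)\<^sup>2 * omega \<kappa> t * (M t)\<^sup>2 * \<Delta>"
  proof (cases "t = 1")
    case True
    have "(\<Sum>s=1..S 1. real s) = (\<Gamma> 1)\<^sup>2 * omega \<kappa> 1 * (M 1)\<^sup>2 * \<Delta>"
      using params unfolding inner_params_def by blast
    then show ?thesis using True \<Gamma> by (simp add: delta_def sum_distrib_left)
  next
    case False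
    have "\<Gamma> t * (\<Sum>s=1..S t. \<delta> t s) = (\<Sum>s=1..S t. \<Gamma> t * W t * M t + (real s - 1))"
      using False \<Gamma> by (simp add: delta_def sum_distrib_left distrib_left mult_ac)
    moreover have "\<dots> = (\<Gamma> t)\<^sup>2 * omega \<kappa> t * (M t)\<^sup>2 * \<Delta>"
    proof -
      have "t \<in> {2..N}" using False t by auto
      then show ?thesis using params unfolding inner_params_def by blast
    qed
    ultimately show ?thesis by simp
  qed
  then show ?thesis using \<Gamma> by (simp add: power2_eq_square)
qed

lemma weight_eq:
  assumes t: "1 \<le> t" "t \<le> N"
  shows "w t s = \<delta> t s / (\<Gamma> t * (M t)\<^sup>2 * \<Delta>)"
  unfolding weight_def sum_delta[OF t] using omega_pos[of t] t by simp

lemma weight_pos: "1 \<le> t \<Longrightarrow> t \<le> N \<Longrightarrow> 1 \<le> s \<Longrightarrow> w t s > 0"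
  using \<Gamma>_ge_1[of t] delta_pos[of t s] M[of t] \<Delta> by (simp add: weight_eq)

lemma sum_weight: "1 \<le> t \<Longrightarrow> t \<le> N \<Longrightarrow> (\<Sum>s=1..S t. w t s) = omega \<kappa> t"
  using \<Gamma>_ge_1[of t] omega_pos[of t] M[of t] \<Delta>
  unfolding weight_eq sum_divide_distrib[symmetric] sum_delta by simp

text \<open>The dual proximal terms carry one and the same weight throughout the run, so that they
  telescope across phases.\<close>

lemma weight_mult_gamma:
  "1 \<le> t \<Longrightarrow> t \<le> N \<Longrightarrow> 1 \<le> s \<Longrightarrow> w t s * \<gamma> t s = 4 / (\<alpha> * \<Delta>)"
  using \<Gamma>_ge_1[of t] delta_pos[of t s] M[of t] \<Delta> \<alpha> by (simp add: weight_eq gamma_def field_simps)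

lemma beta_Suc:
  assumes t: "1 \<le> t" "t \<le> N" and s: "1 \<le> s"
  shows "\<beta> t (Suc s) = \<alpha> / 4 * (\<Gamma> t * \<delta> t s)"
  using \<Gamma>_ge_1[OF t] s by (auto simp: beta_def delta_def field_simps)

lemma beta_first: "2 \<le> t \<Longrightarrow> \<beta> t 1 = \<alpha> / 4 * (\<Gamma> t * \<delta> t 1)"
  by (simp add: beta_def delta_def)

lemma beta_nonneg:
  assumes t: "1 \<le> t" "t \<le> N" and s: "1 \<le> s"
  shows "\<beta> t s \<ge> 0"
  using \<Gamma>_ge_1[OF t] W_pos[of t] M[of t] \<alpha> assms by (auto simp: beta_def)

lemma \<Gamma>_mult_delta_Suc:
  assumes t: "1 \<le> t" "t \<le> N" and s: "1 \<le> s"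
  shows "\<alpha> / 4 * (\<Gamma> t * \<delta> t (Suc s)) \<le> \<alpha> / 2 + \<beta> t s"
  using \<Gamma>_ge_1[OF t] s \<alpha> by (auto simp: beta_def delta_def field_simps)

lemma delta_mono:
  assumes t: "1 \<le> t" "t \<le> N"
  shows "\<delta> t s \<le> \<delta> t (Suc s)"
  using \<Gamma>_ge_1[OF t] by (auto simp: delta_def divide_right_mono)

lemma delta_le_beta:
  assumes t: "1 \<le> t" "t \<le> N" and s: "1 \<le> s"
  shows "\<alpha> / 4 * (\<Gamma> t * \<delta> t s) \<le> \<alpha> / 2 + \<beta> t s"
proof -
  have "\<alpha> / 4 * (\<Gamma> t * \<delta> t s) \<le> \<alpha> / 4 * (\<Gamma> t * \<delta> t (Suc s))"
    using \<Gamma>_ge_1[OF t] delta_mono[OF t, of s] \<alpha> by (intro mult_left_mono) auto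
  then show ?thesis using \<Gamma>_mult_delta_Suc[OF assms] by linarith
qed

lemma weight_mult_rho:
  assumes t: "1 \<le> t" "t \<le> N" and s: "1 \<le> s"
  shows "w t (Suc s) * \<rho> t (Suc s) = w t s"
  using delta_pos[OF t, of "Suc s"] s by (simp add: weight_eq[OF t] rho_def)

lemma weight_mult_rho_first:
  assumes t: "1 \<le> t" "Suc t \<le> N"
  shows "w (Suc t) 1 * \<rho> (Suc t) 1 = w t (S t)"
  using weight_pos[of "Suc t" 1] t by (simp add: rho_def)

text \<open>The cross term between two inner steps has the coefficient \<open>w M\<close>, and the right side is the
  product of the coefficients of the two squares that have to absorb it. Since the weights are
  normalized by \<open>\<Gamma> M\<^sup>2 \<Delta>\<close>, both \<open>M\<close> and \<open>\<Delta>\<close> cancel.\<close>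

lemma weight_mult_M_le:
  assumes t: "1 \<le> t" "t \<le> N" and b: "\<alpha> / 4 * \<delta> t s \<le> \<Gamma> t * b" and s: "1 \<le> s"
  shows "(w t s * M t)\<^sup>2 \<le> 4 / (\<alpha> * \<Delta>) * (w t s * b)"
proof -
  define v where "v = \<Gamma> t * (M t)\<^sup>2 * \<Delta>"
  have v: "v > 0" using \<Gamma>_ge_1[OF t] M[of t] \<Delta> by (simp add: v_def)
  have d: "\<delta> t s = w t s * v"
    using v unfolding weight_eq[OF t] v_def[symmetric] by simp
  have wp: "w t s > 0" using weight_pos[OF t s] .
  have "w t s * (M t)\<^sup>2 * \<Delta> \<le> 4 / \<alpha> * b"
  proof -
    have "\<Gamma> t * (\<alpha> / 4 * (w t s * (M t)\<^sup>2 * \<Delta>)) \<le> \<Gamma> t * b"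
      using b unfolding d v_def by (simp add: mult_ac)
    then have "\<alpha> / 4 * (w t s * (M t)\<^sup>2 * \<Delta>) \<le> b"
      using \<Gamma>_ge_1[OF t] by (subst (asm) mult_le_cancel_left_pos) auto
    then show ?thesis using \<alpha> by (simp add: field_simps)
  qed
  then have "w t s / \<Delta> * (w t s * (M t)\<^sup>2 * \<Delta>) \<le> w t s / \<Delta> * (4 / \<alpha> * b)"
    using wp \<Delta> by (intro mult_left_mono) auto
  then show ?thesis using \<Delta> by (simp add: power_mult_distrib power2_eq_square mult_ac)
qed

text \<open>The first inequality lets Young's inequality absorb the cross term, the second lets the primal
  distances telescope. The primal stepsize is proportional to the preceding \<open>\<delta>\<close>; so the first
  follows from \<open>\<Gamma> \<ge> 1\<close> and the monotonicity of \<open>\<delta>\<close>, the second from the growth of \<open>\<delta>\<close> by only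
  \<open>1 / \<Gamma>\<close> per step.\<close>

lemma step_within_phase:
  assumes t: "1 \<le> t" "t \<le> N" and s: "1 \<le> s"
  shows "(w t s * M t)\<^sup>2 \<le> 4 / (\<alpha> * \<Delta>) * (w t (Suc s) * \<beta> t (Suc s))"
    and "w t (Suc s) * \<beta> t (Suc s) \<le> w t s * (\<alpha> / 2 + \<beta> t s)"
proof -
  have p: "\<delta> t s > 0" "\<delta> t (Suc s) > 0" using delta_pos[OF t] s by auto
  have \<Gamma>: "\<Gamma> t \<ge> 1" by (rule \<Gamma>_ge_1[OF t])
  have eq: "w t (Suc s) * \<beta> t (Suc s) = w t s * (\<alpha> / 4 * (\<Gamma> t * \<delta> t (Suc s)))"
    by (simp add: beta_Suc[OF t s] weight_eq[OF t])
  have "\<alpha> / 4 * \<delta> t s \<le> \<Gamma> t * (\<alpha> / 4 * (\<Gamma> t * \<delta> t (Suc s)))"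
  proof -
    have "1 * \<delta> t s \<le> \<Gamma> t * (\<Gamma> t * \<delta> t (Suc s))"
      using \<Gamma> p delta_mono[OF t, of s] mult_mono[of 1 "\<Gamma> t" "\<delta> t s" "\<delta> t (Suc s)"]
      by (intro mult_mono) auto
    then have "\<alpha> / 4 * (1 * \<delta> t s) \<le> \<alpha> / 4 * (\<Gamma> t * (\<Gamma> t * \<delta> t (Suc s)))"
      using \<alpha> by (intro mult_left_mono) auto
    then show ?thesis by (simp add: mult_ac)
  qed
  from weight_mult_M_le[OF t this s]
  show "(w t s * M t)\<^sup>2 \<le> 4 / (\<alpha> * \<Delta>) * (w t (Suc s) * \<beta> t (Suc s))"
    unfolding eq .
  show "w t (Suc s) * \<beta> t (Suc s) \<le> w t s * (\<alpha> / 2 + \<beta> t s)"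
    unfolding eq using \<Gamma>_mult_delta_Suc[OF assms] weight_pos[OF assms]
    by (intro mult_left_mono) auto
qed

text \<open>The same two inequalities at the passage to a new phase. Handing over the quotient of \<open>\<delta>\<close> and
  \<open>M\<close> as \<open>W\<close> compensates the change of the operator norm, and makes the weighted
  primal stepsize \<open>w \<beta>\<close> of the new phase a multiple of the last weight of the old one.\<close>

lemma step_between_phases:
  assumes t: "1 \<le> t" "Suc t \<le> N"
  shows "(w t (S t) * M t)\<^sup>2 \<le> 4 / (\<alpha> * \<Delta>) * (w (Suc t) 1 * \<beta> (Suc t) 1)"
    and "w (Suc t) 1 * \<beta> (Suc t) 1 \<le> w t (S t) * (\<alpha> / 2 + \<beta> t (S t))"
proof -
  have t': "1 \<le> t" "t \<le> N" "1 \<le> Suc t" using t by auto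
  have S: "1 \<le> S t" using S_ge_1 t' by auto
  have \<Gamma>: "\<Gamma> t \<ge> 1" "\<Gamma> (Suc t) \<ge> 1" using \<Gamma>_ge_1 t by auto
  have d: "\<delta> t (S t) > 0" using delta_pos[OF t'(1,2) S] .
  have W: "W (t + 1) = \<delta> t (S t) / M t"
    using params t by (auto simp: inner_params_def)
  have d1: "\<delta> (Suc t) 1 = \<delta> t (S t) / M t * M (Suc t)"
    using W t by (simp add: delta_def)
  have eq: "w (Suc t) 1 * \<beta> (Suc t) 1 = w t (S t) * (\<alpha> / 4 * (\<Gamma> t * \<delta> t (S t)))"
    using beta_first[of "Suc t"] t \<Gamma> \<Delta> M[of t] M[of "Suc t"] \<alpha>
    unfolding weight_eq[OF t'(3) t(2)] weight_eq[OF t'(1,2)]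
    by (simp add: d1[simplified] power2_eq_square)
  have "\<alpha> / 4 * \<delta> t (S t) \<le> \<Gamma> t * (\<alpha> / 4 * (\<Gamma> t * \<delta> t (S t)))"
  proof -
    have "1 * \<delta> t (S t) \<le> (\<Gamma> t * \<Gamma> t) * \<delta> t (S t)"
      using \<Gamma> d mult_mono[of 1 "\<Gamma> t" 1 "\<Gamma> t"] by (intro mult_right_mono) auto
    then have "\<alpha> / 4 * (1 * \<delta> t (S t)) \<le> \<alpha> / 4 * ((\<Gamma> t * \<Gamma> t) * \<delta> t (S t))"
      using \<alpha> by (intro mult_left_mono) auto
    then show ?thesis by (simp add: mult_ac)
  qed
  from weight_mult_M_le[OF t'(1,2) this S]
  show "(w t (S t) * M t)\<^sup>2 \<le> 4 / (\<alpha> * \<Delta>) * (w (Suc t) 1 * \<beta> (Suc t) 1)"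
    unfolding eq .
  show "w (Suc t) 1 * \<beta> (Suc t) 1 \<le> w t (S t) * (\<alpha> / 2 + \<beta> t (S t))"
    unfolding eq using delta_le_beta[OF t'(1,2) S] weight_pos[OF t'(1,2) S]
    by (intro mult_left_mono) auto
qed

lemma step_final:
  assumes t: "1 \<le> t" "t \<le> N" and s: "1 \<le> s"
  shows "(w t s * M t)\<^sup>2 \<le> 4 / (\<alpha> * \<Delta>) * (w t s * (\<alpha> / 2 + \<beta> t s))"
proof (rule weight_mult_M_le[OF t _ s])
  have \<Gamma>: "\<Gamma> t \<ge> 1" by (rule \<Gamma>_ge_1[OF t])
  have "\<alpha> / 4 * \<delta> t s \<le> \<alpha> / 4 * (\<Gamma> t * \<delta> t s)"
    using \<alpha> \<Gamma> delta_pos[OF assms] by (intro mult_left_mono) auto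
  also have "\<dots> \<le> 1 * (\<alpha> / 2 + \<beta> t s)" using delta_le_beta[OF assms] by simp
  also have "\<dots> \<le> \<Gamma> t * (\<alpha> / 2 + \<beta> t s)"
    using \<Gamma> \<alpha> beta_nonneg[OF assms] by (intro mult_right_mono) auto
  finally show "\<alpha> / 4 * \<delta> t s \<le> \<Gamma> t * (\<alpha> / 2 + \<beta> t s)" .
qed

end

section \<open>One accelerated step of the outer loop\<close>

text \<open>The point \<open>z1\<close> at which the gradient is evaluated is a weighted average of \<open>z0\<close> and the
  extrapolated point \<open>xt\<close>. Since tangents are affine, the gap at \<open>xt\<close> between the tangent at an
  arbitrary \<open>xh\<close> and the tangent at \<open>z1\<close> is a difference of Bregman distances; this replaces
  the proximal step in the conjugate of \<open>h\<close>.\<close>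

lemma tangent_gap_at_extrapolation:
  fixes h :: "'a::real_inner \<Rightarrow> real"
  assumes z1: "(1 + \<tau>) *\<^sub>R z1 = \<tau> *\<^sub>R z0 + xt"
    and E: "\<And>z. E z = h z - h xh - G xh \<bullet> (z - xh)"
  shows "h xh + G xh \<bullet> (xt - xh) - h z1 - G z1 \<bullet> (xt - z1)
    = \<tau> * E z0 - (1 + \<tau>) * E z1 - \<tau> * (h z0 - h z1 - G z1 \<bullet> (z0 - z1))"
proof -
  have xt: "xt = z1 + \<tau> *\<^sub>R (z1 - z0)"
    using z1 by (simp add: algebra_simps)
  show ?thesis
    unfolding xt E by (simp add: inner_diff_right inner_add_right algebra_simps)
qed

text \<open>Here \<open>z\<close> is the point at which the gradient was last evaluated and \<open>d\<close> the last displacement.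
  The Bregman distance from \<open>xh\<close> to \<open>z\<close> and the square of \<open>d\<close> are what remains available to
  pay for the product of gradient change and displacement.\<close>

definition outer_potential ::
  "real \<Rightarrow> real \<Rightarrow> real \<Rightarrow> ('a::real_inner \<Rightarrow> real) \<Rightarrow> ('a \<Rightarrow> 'a) \<Rightarrow> 'a \<Rightarrow> 'a \<Rightarrow> 'a \<Rightarrow> real" where
  "outer_potential \<omega> \<tau> e h G xh z d =
     \<omega> * (1 + \<tau>) * (h z - h xh - G xh \<bullet> (z - xh)) + \<omega> * e / 2 * (norm d)\<^sup>2
       - \<omega> * ((G xh - G z) \<bullet> d)"

lemma scaled_Young_inner:
  fixes a b :: "'a::real_inner"
  assumes "r\<^sup>2 \<le> p * q" "p \<ge> 0" "q \<ge> 0" "r \<ge> 0"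
  shows "r * (a \<bullet> b) \<le> p / 2 * (norm a)\<^sup>2 + q / 2 * (norm b)\<^sup>2"
proof -
  have "r * (a \<bullet> b) \<le> r * (1 * norm a * norm b)"
    using norm_cauchy_schwarz[of a b] assms by (intro mult_left_mono) auto
  also have "\<dots> \<le> p / 2 * (norm a)\<^sup>2 + q / 2 * (norm b)\<^sup>2"
    using assms by (intro scaled_Young) auto
  finally show ?thesis .
qed

lemma outer_potential_nonneg:
  fixes h :: "'a::real_inner \<Rightarrow> real"
  assumes conv: "convex_on UNIV h" and G: "\<And>z. GDERIV h z :> G z"
    and lip: "K-lipschitz_on UNIV G" and K: "K > 0"
    and par: "\<omega> \<ge> 0" "\<tau> \<ge> 0" "K \<le> (1 + \<tau>) * e"
  shows "outer_potential \<omega> \<tau> e h G xh z d \<ge> 0"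
proof -
  have e: "e \<ge> 0"
    using par K by (smt (verit) mult_nonneg_nonpos)
  have "\<omega> * ((G xh - G z) \<bullet> d)
      \<le> (\<omega> * (1 + \<tau>) / K) / 2 * (norm (G xh - G z))\<^sup>2 + (\<omega> * e) / 2 * (norm d)\<^sup>2"
  proof (rule scaled_Young_inner)
    have "\<omega>\<^sup>2 / K * K \<le> \<omega>\<^sup>2 / K * ((1 + \<tau>) * e)" using par K by (intro mult_left_mono) auto
    then show "\<omega>\<^sup>2 \<le> \<omega> * (1 + \<tau>) / K * (\<omega> * e)"
      using K by (simp add: power2_eq_square mult_ac)
  qed (use par K e in auto)
  moreover have "\<omega> * (1 + \<tau>) * ((norm (G z - G xh))\<^sup>2 / (2 * K))
      \<le> \<omega> * (1 + \<tau>) * (h z - h xh - G xh \<bullet> (z - xh))"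
    using Bregman_ge_gradient_difference[OF conv G lip K, of z xh] par by (intro mult_left_mono) auto
  moreover have "\<omega> * (1 + \<tau>) * ((norm (G z - G xh))\<^sup>2 / (2 * K))
      = (\<omega> * (1 + \<tau>) / K) / 2 * (norm (G xh - G z))\<^sup>2"
    by (simp add: norm_minus_commute)
  ultimately show ?thesis unfolding outer_potential_def by linarith
qed

text \<open>The tangent of \<open>h\<close> at \<open>xh\<close> minus its tangent at \<open>z1\<close>, evaluated at the new iterate
  \<open>x1\<close>, is the gap at the extrapolated point plus the gradient difference times the displacement
  from there to \<open>x1\<close>. The latter telescopes up to the product of the last gradient change with the
  preceding displacement, which the Bregman distance between \<open>z0\<close> and \<open>z1\<close> and the preceding
  proximal term absorb.\<close>

lemma outer_step:
  fixes h :: "'a::real_inner \<Rightarrow> real"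
  assumes conv: "convex_on UNIV h" and G: "\<And>z. GDERIV h z :> G z"
    and lip: "K-lipschitz_on UNIV G" and K: "K > 0"
    and z1: "(1 + \<tau>1) *\<^sub>R z1 = \<tau>1 *\<^sub>R z0 + (xc + \<theta> *\<^sub>R d)"
    and par: "\<omega>0 \<ge> 0" "\<omega>1 \<ge> 0" "\<tau>0 \<ge> 0" "\<tau>1 \<ge> 0" "K \<le> (1 + \<tau>0) * e0"
    and \<theta>: "(\<omega>1 * \<theta>) *\<^sub>R d = \<omega>0 *\<^sub>R d" and \<tau>: "\<omega>1 * \<tau>1 = \<omega>0 * (1 + \<tau>0)"
  shows "\<omega>1 * (h xh + G xh \<bullet> (x1 - xh) - h z1 - G z1 \<bullet> (x1 - z1))
    \<le> outer_potential \<omega>0 \<tau>0 e0 h G xh z0 d - outer_potential \<omega>1 \<tau>1 e1 h G xh z1 (x1 - xc)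
      + \<omega>1 * e1 / 2 * (norm (x1 - xc))\<^sup>2"
proof -
  let ?E = "\<lambda>z. h z - h xh - G xh \<bullet> (z - xh)" and ?xt = "xc + \<theta> *\<^sub>R d"
  have e0: "e0 \<ge> 0" using par K by (smt (verit) mult_nonneg_nonpos)
  have gap: "h xh + G xh \<bullet> (?xt - xh) - h z1 - G z1 \<bullet> (?xt - z1)
    = \<tau>1 * ?E z0 - (1 + \<tau>1) * ?E z1 - \<tau>1 * (h z0 - h z1 - G z1 \<bullet> (z0 - z1))"
    by (rule tangent_gap_at_extrapolation[OF z1]) simp
  have split: "h xh + G xh \<bullet> (x1 - xh) - h z1 - G z1 \<bullet> (x1 - z1)
    = (h xh + G xh \<bullet> (?xt - xh) - h z1 - G z1 \<bullet> (?xt - z1))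
      + (G xh - G z1) \<bullet> (x1 - xc) - \<theta> * ((G xh - G z1) \<bullet> d)"
    by (simp add: inner_diff_right inner_diff_left inner_add_right algebra_simps)
  have "\<omega>1 * (\<theta> * ((G xh - G z1) \<bullet> d)) = (G xh - G z1) \<bullet> ((\<omega>1 * \<theta>) *\<^sub>R d)"
    by simp
  also have "\<dots> = \<omega>0 * ((G xh - G z1) \<bullet> d)" unfolding \<theta> by simp
  also have "\<dots> = \<omega>0 * ((G xh - G z0) \<bullet> d) - \<omega>0 * ((G z1 - G z0) \<bullet> d)"
    by (simp add: inner_diff_left algebra_simps)
  finally have ext: "\<omega>1 * (\<theta> * ((G xh - G z1) \<bullet> d))
      = \<omega>0 * ((G xh - G z0) \<bullet> d) - \<omega>0 * ((G z1 - G z0) \<bullet> d)" .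
  have "\<omega>0 * ((G z1 - G z0) \<bullet> d)
      \<le> (\<omega>0 * (1 + \<tau>0) / K) / 2 * (norm (G z1 - G z0))\<^sup>2 + (\<omega>0 * e0) / 2 * (norm d)\<^sup>2"
  proof (rule scaled_Young_inner)
    have "\<omega>0\<^sup>2 / K * K \<le> \<omega>0\<^sup>2 / K * ((1 + \<tau>0) * e0)" using par K by (intro mult_left_mono) auto
    then show "\<omega>0\<^sup>2 \<le> \<omega>0 * (1 + \<tau>0) / K * (\<omega>0 * e0)"
      using K by (simp add: power2_eq_square mult_ac)
  qed (use par K e0 in auto)
  moreover have "\<omega>1 * \<tau>1 * ((norm (G z0 - G z1))\<^sup>2 / (2 * K))
      \<le> \<omega>1 * \<tau>1 * (h z0 - h z1 - G z1 \<bullet> (z0 - z1))"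
    using Bregman_ge_gradient_difference[OF conv G lip K, of z0 z1] par by (intro mult_left_mono) auto
  moreover have "\<omega>1 * \<tau>1 * ((norm (G z0 - G z1))\<^sup>2 / (2 * K))
      = (\<omega>0 * (1 + \<tau>0) / K) / 2 * (norm (G z1 - G z0))\<^sup>2"
    unfolding \<tau> by (simp add: norm_minus_commute)
  ultimately have cross: "\<omega>0 * ((G z1 - G z0) \<bullet> d)
      \<le> \<omega>1 * \<tau>1 * (h z0 - h z1 - G z1 \<bullet> (z0 - z1)) + \<omega>0 * e0 / 2 * (norm d)\<^sup>2"
    by linarith
  have "\<omega>1 * (h xh + G xh \<bullet> (x1 - xh) - h z1 - G z1 \<bullet> (x1 - z1))
    = \<omega>1 * \<tau>1 * ?E z0 - \<omega>1 * (1 + \<tau>1) * ?E z1 - \<omega>1 * \<tau>1 * (h z0 - h z1 - G z1 \<bullet> (z0 - z1))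
      + \<omega>1 * ((G xh - G z1) \<bullet> (x1 - xc)) - \<omega>1 * (\<theta> * ((G xh - G z1) \<bullet> d))"
    unfolding split gap by (simp add: algebra_simps)
  also have "\<dots> \<le> \<omega>0 * (1 + \<tau>0) * ?E z0 - \<omega>1 * (1 + \<tau>1) * ?E z1
      + \<omega>1 * ((G xh - G z1) \<bullet> (x1 - xc)) - \<omega>0 * ((G xh - G z0) \<bullet> d) + \<omega>0 * e0 / 2 * (norm d)\<^sup>2"
    using cross unfolding ext \<tau> by linarith
  finally show ?thesis unfolding outer_potential_def by linarith
qed

section \<open>Weighted averages\<close>

lemma convex_on_norm_diff_square:
  fixes p :: "'a::real_inner"
  assumes "convex C"
  shows "convex_on C (\<lambda>v. (norm (v - p))\<^sup>2)"
proof (rule convex_onI)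
  fix t :: real and v w assume t: "0 < t" "t < 1" and vw: "v \<in> C" "w \<in> C"
  have "0 \<le> t * (1 - t) * (norm (v - w))\<^sup>2" using t by simp
  moreover have "t \<in> {0..1}" using t by simp
  note strongly_convex_on_square[OF assms, of 2 p, unfolded strongly_convex_on_def, THEN conjunct2,
      THEN bspec, OF vw(1), THEN bspec, OF vw(2), THEN bspec, OF this]
  ultimately show "(norm ((1 - t) *\<^sub>R v + t *\<^sub>R w - p))\<^sup>2
      \<le> (1 - t) * (norm (v - p))\<^sup>2 + t * (norm (w - p))\<^sup>2"
    by simp
qed fact

lemma weighted_Jensen:
  fixes \<phi> :: "'a::real_vector \<Rightarrow> real"
  assumes \<phi>: "convex_on C \<phi>" and I: "finite I" and a: "\<And>i. i \<in> I \<Longrightarrow> a i \<ge> 0"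
    and A: "(\<Sum>i\<in>I. a i) = A" "A > 0" and y: "\<And>i. i \<in> I \<Longrightarrow> y i \<in> C"
  shows "A * \<phi> ((\<Sum>i\<in>I. a i *\<^sub>R y i) /\<^sub>R A) \<le> (\<Sum>i\<in>I. a i * \<phi> (y i))"
    and "(\<Sum>i\<in>I. a i *\<^sub>R y i) /\<^sub>R A \<in> C"
proof -
  have I0: "I \<noteq> {}" using A by auto
  have one: "(\<Sum>i\<in>I. a i / A) = 1" using A by (simp flip: sum_divide_distrib)
  have C: "convex C" using \<phi> by (rule convex_on_imp_convex)
  have avg: "(\<Sum>i\<in>I. a i *\<^sub>R y i) /\<^sub>R A = (\<Sum>i\<in>I. (a i / A) *\<^sub>R y i)"
    by (simp add: scaleR_sum_right divide_inverse mult.commute)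
  show "(\<Sum>i\<in>I. a i *\<^sub>R y i) /\<^sub>R A \<in> C"
    unfolding avg using I C one a A y by (intro convex_sum) auto
  have "\<phi> (\<Sum>i\<in>I. (a i / A) *\<^sub>R y i) \<le> (\<Sum>i\<in>I. a i / A * \<phi> (y i))"
    using I I0 \<phi> one a A y by (intro convex_on_sum) auto
  also have "\<dots> = (\<Sum>i\<in>I. a i * \<phi> (y i)) / A"
    by (simp add: sum_divide_distrib)
  finally show "A * \<phi> ((\<Sum>i\<in>I. a i *\<^sub>R y i) /\<^sub>R A) \<le> (\<Sum>i\<in>I. a i * \<phi> (y i))"
    using A unfolding avg by (simp add: field_simps)
qed

section \<open>The primal-dual estimate for a run\<close>

locale acgd_s =
  fixes f u :: "real^'n \<Rightarrow> real" and g :: "real^'n \<Rightarrow> real^'m" and X :: "(real^'n) set"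
    and \<alpha> Lc R :: real and x0 :: "real^'n" and N :: nat
    and x xu :: "nat \<Rightarrow> real^'n" and y :: "nat \<Rightarrow> nat \<Rightarrow> real^'n"
    and lam :: "nat \<Rightarrow> nat \<Rightarrow> real^'m" and lamm :: "nat \<Rightarrow> real^'m"
    and S :: "nat \<Rightarrow> nat" and \<Gamma> W :: "nat \<Rightarrow> real"
  assumes f: "convex_on UNIV f" "\<And>v. f differentiable (at v)"
    and g: "\<And>i. convex_on UNIV (\<lambda>v. g v $ i)" "\<And>v. g differentiable (at v)"
    and u: "convex_on X u" "strongly_convex_on X \<alpha> u"
    and pos: "\<alpha> > 0" "Lc \<ge> \<alpha>" "R > 0" "N \<ge> 1"
    and run: "acgd_s_run f g u X \<alpha> Lc R x0 N x xu y lam lamm S \<Gamma> W"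

sublocale acgd_s \<subseteq> inner_stepsizes \<alpha> "Lc / \<alpha>" "R\<^sup>2 / (\<alpha> * Lc)" N "phase_M g xu" \<Gamma> W S
proof
  show "inner_params (Lc / \<alpha>) (R\<^sup>2 / (\<alpha> * Lc)) N (phase_M g xu) S \<Gamma> W"
    using run by (simp add: acgd_s_run_def Let_def)
qed (use pos in \<open>auto simp: phase_M_def Let_def\<close>)

context acgd_s
begin

abbreviation "\<omega> \<equiv> omega (Lc / \<alpha>)"
abbreviation "\<tau> \<equiv> tau (Lc / \<alpha>)"
abbreviation "\<eta> \<equiv> eta Lc (Lc / \<alpha>)"
abbreviation "\<nu> t \<equiv> jacobian g (at (xu t))"
abbreviation "\<pi> t \<equiv> gradient f (xu t)"
abbreviation "M \<equiv> phase_M g xu"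

lemma Lc_pos: "Lc > 0"
  using pos by linarith

lemma kappa_pos: "Lc / \<alpha> > 0"
  using \<kappa> by linarith

lemma matrix_norm_le_M: "matrix_norm (\<nu> t) \<le> M t"
  by (simp add: phase_M_def Let_def)

lemma initial: "x 0 = x0" "xu 0 = x0" "y 1 0 = x0" "lam 1 0 = 0" "lamm 1 = 0"
  using run by (simp_all add: acgd_s_run_def Let_def)

lemmas run_phase = run[unfolded acgd_s_run_def Let_def, THEN conjunct2, THEN conjunct2,
    THEN conjunct2, THEN conjunct2, THEN conjunct2, THEN conjunct2, THEN bspec]

lemma phase:
  assumes "1 \<le> t" "t \<le> N"
  shows xu_eq: "xu t = (\<tau> t *\<^sub>R xu (t - 1)
        + (x (t - 1) + theta (Lc / \<alpha>) t *\<^sub>R (x (t - 1) - x (t - 2)))) /\<^sub>R (1 + \<tau> t)"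
    and next_phase: "lam (t + 1) 0 = lam t (S t)" "lamm (t + 1) = lam t (S t - 1)"
      "y (t + 1) 0 = y t (S t)"
    and x_eq: "x t = (\<Sum>s=1..S t. \<delta> t s *\<^sub>R y t s) /\<^sub>R (\<Sum>s=1..S t. \<delta> t s)"
proof -
  have "t \<in> {1..N}" using assms by simp
  note * = run_phase[OF this]
  from * show "xu t = (\<tau> t *\<^sub>R xu (t - 1)
        + (x (t - 1) + theta (Lc / \<alpha>) t *\<^sub>R (x (t - 1) - x (t - 2)))) /\<^sub>R (1 + \<tau> t)"
    by (rule conjunct1)
  note * = *[THEN conjunct2, THEN conjunct2]
  show "lam (t + 1) 0 = lam t (S t)" "lamm (t + 1) = lam t (S t - 1)"
      "y (t + 1) 0 = y t (S t)" "x t = (\<Sum>s=1..S t. \<delta> t s *\<^sub>R y t s) /\<^sub>R (\<Sum>s=1..S t. \<delta> t s)"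
    using * by blast+
qed

lemma dual_step:
  assumes "1 \<le> t" "t \<le> N" "1 \<le> s" "s \<le> S t"
  shows "is_arg_max (\<lambda>l. l \<bullet> (\<nu> t *v (y t s - xu t) + g (xu t))
      - \<gamma> t s / 2 * (norm (l - lam t (s - 1)))\<^sup>2) (\<lambda>l. 0 \<le> l) (lam t s)"
proof -
  have "t \<in> {1..N}" "s \<in> {1..S t}" using assms by auto
  then show ?thesis
    by (rule run_phase[THEN conjunct2, THEN conjunct1, THEN bspec, THEN conjunct2])
qed

lemma primal_step_raw:
  assumes "1 \<le> t" "t \<le> N" "1 \<le> s" "s \<le> S t"
  shows "is_arg_min (\<lambda>v. ((if s = 1
                then transpose (\<nu> t) *v lam t 0
                     + \<rho> t 1 *\<^sub>R (transpose (\<nu> (t - 1)) *v (lam t 0 - lamm t))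
                else transpose (\<nu> t) *v lam t (s - 1)
                     + \<rho> t s *\<^sub>R (transpose (\<nu> t) *v (lam t (s - 1) - lam t (s - 2)))) + \<pi> t) \<bullet> v
      + u v + \<eta> t / 2 * (norm (v - x (t - 1)))\<^sup>2
      + \<beta> t s / 2 * (norm (v - y t (s - 1)))\<^sup>2) (\<lambda>v. v \<in> X) (y t s)"
proof -
  have "t \<in> {1..N}" "s \<in> {1..S t}" using assms by auto
  then show ?thesis
    by (rule run_phase[THEN conjunct2, THEN conjunct1, THEN bspec, THEN conjunct1])
qed

lemma primal_step:
  assumes "1 \<le> t" "t \<le> N" "1 \<le> s" "Suc s \<le> S t"
  shows "is_arg_min (\<lambda>v. (transpose (\<nu> t) *v lam t s
        + \<rho> t (Suc s) *\<^sub>R (transpose (\<nu> t) *v (lam t s - lam t (s - 1))) + \<pi> t) \<bullet> v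
      + u v + \<eta> t / 2 * (norm (v - x (t - 1)))\<^sup>2
      + \<beta> t (Suc s) / 2 * (norm (v - y t s))\<^sup>2) (\<lambda>v. v \<in> X) (y t (Suc s))"
  using primal_step_raw[of t "Suc s"] assms by (simp del: transpose_matrix_vector)

lemma primal_step_first:
  assumes "1 \<le> t" "t \<le> N"
  shows "is_arg_min (\<lambda>v. (transpose (\<nu> t) *v lam t 0
        + \<rho> t 1 *\<^sub>R (transpose (\<nu> (t - 1)) *v (lam t 0 - lamm t)) + \<pi> t) \<bullet> v
      + u v + \<eta> t / 2 * (norm (v - x (t - 1)))\<^sup>2
      + \<beta> t 1 / 2 * (norm (v - y t 0))\<^sup>2) (\<lambda>v. v \<in> X) (y t 1)"
  using primal_step_raw[of t 1] assms S_ge_1[of t] by (simp del: transpose_matrix_vector)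

lemma y_in_X: "1 \<le> t \<Longrightarrow> t \<le> N \<Longrightarrow> 1 \<le> s \<Longrightarrow> s \<le> S t \<Longrightarrow> y t s \<in> X"
  using primal_step_raw[of t s] by (simp add: is_arg_min_def)

lemma lam_nonneg: "1 \<le> t \<Longrightarrow> t \<le> N \<Longrightarrow> 1 \<le> s \<Longrightarrow> s \<le> S t \<Longrightarrow> 0 \<le> lam t s"
  using dual_step[of t s] by (simp add: is_arg_max_def)

lemma x_eq_weight:
  assumes t: "1 \<le> t" "t \<le> N"
  shows "x t = (\<Sum>s=1..S t. w t s *\<^sub>R y t s) /\<^sub>R \<omega> t"
proof -
  have o: "\<omega> t \<noteq> 0" using omega_pos[of t] t by simp
  show ?thesis
    unfolding x_eq[OF t] weight_def scaleR_sum_right using o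
    by (intro sum.cong refl) (simp add: divide_inverse mult_ac)
qed

lemma phase_Jensen:
  assumes t: "1 \<le> t" "t \<le> N" and \<phi>: "convex_on X \<phi>"
  shows "\<omega> t * \<phi> (x t) \<le> (\<Sum>s=1..S t. w t s * \<phi> (y t s))"
  unfolding x_eq_weight[OF t]
  using omega_pos[of t] t y_in_X[OF t] weight_pos[OF t] sum_weight[OF t]
  by (intro weighted_Jensen[OF \<phi>]) (auto intro: less_imp_le)

lemma x_in_X: "1 \<le> t \<Longrightarrow> t \<le> N \<Longrightarrow> x t \<in> X"
  unfolding x_eq_weight
  using omega_pos[of t] y_in_X[of t] weight_pos[of t] sum_weight[of t]
  by (intro weighted_Jensen(2)[OF u(1)]) (auto intro: less_imp_le)

lemma eta_nonneg: "t \<ge> 1 \<Longrightarrow> \<eta> t \<ge> 0"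
  using tau_nonneg[of "Lc / \<alpha>" "t + 1"] kappa_pos Lc_pos by (simp add: eta_def)

lemma Lc_le_eta: "t \<ge> 1 \<Longrightarrow> Lc \<le> (1 + \<tau> t) * \<eta> t"
  using tau_pos[of "Lc / \<alpha>" "Suc t"] mult_left_mono[OF tau_Suc_le[of "Lc / \<alpha>" t], of Lc]
    kappa_pos Lc_pos
  by (simp add: eta_def field_simps)

text \<open>A run is compared with a feasible point \<open>xr\<close> and a nonnegative multiplier \<open>lr\<close>. Only \<open>lr\<close> is
  varied in the end, in order to extract the optimality gap, the constraint violation and the
  distance to the solution from one estimate.\<close>

context
  fixes xr :: "real^'n" and lr :: "real^'m"
  assumes xr: "xr \<in> X" "g xr \<le> 0" and lr: "0 \<le> lr"
begin

abbreviation "K \<equiv> 4 / (\<alpha> * (R\<^sup>2 / (\<alpha> * Lc)))"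

abbreviation "\<Phi> t s \<equiv> inner_potential K xr lr (w t s * (\<alpha> / 2 + \<beta> t s)) (w t s) (\<nu> t)
  (lam t (s - 1)) (lam t s) (y t s)"

abbreviation "\<Phi>_start t \<equiv>
  if t = 1 then K / 2 * (norm lr)\<^sup>2 else \<Phi> (t - 1) (S (t - 1))"

abbreviation "gap t s \<equiv> \<pi> t \<bullet> (y t s - xr) + lr \<bullet> (g (xu t) + \<nu> t *v (y t s - xu t))
  - lam t s \<bullet> (g (xu t) + \<nu> t *v (xr - xu t)) + u (y t s) - u xr"

abbreviation "prox_terms t v \<equiv> \<eta> t / 2 * (norm (xr - x (t - 1)))\<^sup>2
  - \<eta> t / 2 * (norm (v - x (t - 1)))\<^sup>2 - (\<eta> t + \<alpha> / 2) / 2 * (norm (xr - v))\<^sup>2"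

lemma K_nonneg: "K \<ge> 0"
  using pos Lc_pos by simp

lemma gap_first:
  assumes t: "1 \<le> t" "t \<le> N"
  shows "w t 1 * gap t 1 \<le> \<Phi>_start t - \<Phi> t 1 + w t 1 * prox_terms t (y t 1)"
proof (cases "t = 1")
  case True
  have D: "is_arg_max (\<lambda>l. l \<bullet> (\<nu> 1 *v (y 1 1 - xu 1) + g (xu 1))
      - \<gamma> 1 1 / 2 * (norm (l - lam 1 0))\<^sup>2) (\<lambda>l. 0 \<le> l) (lam 1 1)"
    using dual_step[of 1 1] S_ge_1[of 1] pos by simp
  have "w 1 1 * gap 1 1
    \<le> inner_potential K xr lr 0 0 (\<nu> (1 - 1)) (lamm 1) (lam 1 0) (y 1 0)
      - inner_potential K xr lr (w 1 1 * (\<alpha> / 2 + \<beta> 1 1)) (w 1 1) (\<nu> 1) (lam 1 0) (lam 1 1) (y 1 1)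
      + w 1 1 * prox_terms 1 (y 1 1)"
    using weight_pos[of 1 1] beta_nonneg[of 1 1] pos K_nonneg weight_mult_gamma[of 1 1] initial
    by (intro inner_step[OF xr(1) u(2) lr primal_step_first D, where m = "matrix_norm (\<nu> (1 - 1))"])
      (auto simp: beta_def)
  then show ?thesis using True initial by (simp add: inner_potential_def)
next
  case False
  define k where "k = t - 1"
  have k: "t = Suc k" "1 \<le> k" "k \<le> N" "Suc k \<le> N" using False t by (auto simp: k_def)
  have D: "is_arg_max (\<lambda>l. l \<bullet> (\<nu> t *v (y t 1 - xu t) + g (xu t))
      - \<gamma> t 1 / 2 * (norm (l - lam t 0))\<^sup>2) (\<lambda>l. 0 \<le> l) (lam t 1)"
    using dual_step[of t 1] S_ge_1[of t] t by simp
  have "w t 1 * gap t 1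
    \<le> inner_potential K xr lr (w k (S k) * (\<alpha> / 2 + \<beta> k (S k))) (w k (S k)) (\<nu> (t - 1))
        (lamm t) (lam t 0) (y t 0)
      - inner_potential K xr lr (w t 1 * (\<alpha> / 2 + \<beta> t 1)) (w t 1) (\<nu> t) (lam t 0) (lam t 1) (y t 1)
      + w t 1 * prox_terms t (y t 1)"
  proof (rule inner_step[OF xr(1) u(2) lr primal_step_first[OF t] D, where m = "M k"])
    show "(w t 1 * \<rho> t 1) *\<^sub>R (lam t 0 - lamm t) = w k (S k) *\<^sub>R (lam t 0 - lamm t)"
      using weight_mult_rho_first[OF k(2,4)] k by simp
    show "matrix_norm (\<nu> (t - 1)) \<le> M k" using matrix_norm_le_M[of k] k by simp
    show "(w k (S k) * M k)\<^sup>2 \<le> K * (w t 1 * \<beta> t 1)"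
      "w t 1 * \<beta> t 1 \<le> w k (S k) * (\<alpha> / 2 + \<beta> k (S k))"
      using step_between_phases[OF k(2,4)] k by auto
  qed (use weight_pos[OF t, of 1] weight_pos[OF k(2,3) S_ge_1[OF k(2,3)]] beta_nonneg[OF t, of 1]
      pos K_nonneg weight_mult_gamma[OF t, of 1] in auto)
  then show ?thesis using False next_phase[OF k(2,3)] k by simp
qed

lemma gap_next:
  assumes t: "1 \<le> t" "t \<le> N" and s: "1 \<le> s" "Suc s \<le> S t"
  shows "w t (Suc s) * gap t (Suc s)
    \<le> \<Phi> t s - \<Phi> t (Suc s) + w t (Suc s) * prox_terms t (y t (Suc s))"
proof -
  have D: "is_arg_max (\<lambda>l. l \<bullet> (\<nu> t *v (y t (Suc s) - xu t) + g (xu t))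
      - \<gamma> t (Suc s) / 2 * (norm (l - lam t s))\<^sup>2) (\<lambda>l. 0 \<le> l) (lam t (Suc s))"
    using dual_step[of t "Suc s"] t s by simp
  have "w t (Suc s) * gap t (Suc s)
    \<le> \<Phi> t s - inner_potential K xr lr (w t (Suc s) * (\<alpha> / 2 + \<beta> t (Suc s))) (w t (Suc s)) (\<nu> t)
        (lam t s) (lam t (Suc s)) (y t (Suc s))
      + w t (Suc s) * prox_terms t (y t (Suc s))"
  proof (rule inner_step[OF xr(1) u(2) lr primal_step[OF t s] D, where m = "M t"])
    show "(w t (Suc s) * \<rho> t (Suc s)) *\<^sub>R (lam t s - lam t (s - 1))
        = w t s *\<^sub>R (lam t s - lam t (s - 1))"
      using weight_mult_rho[OF t s(1)] by simp
    show "(w t s * M t)\<^sup>2 \<le> K * (w t (Suc s) * \<beta> t (Suc s))"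
      "w t (Suc s) * \<beta> t (Suc s) \<le> w t s * (\<alpha> / 2 + \<beta> t s)"
      by (rule step_within_phase[OF t s(1)])+
    show "matrix_norm (\<nu> t) \<le> M t" by (rule matrix_norm_le_M)
  qed (use weight_pos[OF t, of "Suc s"] weight_pos[OF t s(1)] beta_nonneg[OF t, of "Suc s"]
      pos K_nonneg weight_mult_gamma[OF t, of "Suc s"] in auto)
  then show ?thesis by simp
qed

lemma sum_gap:
  assumes t: "1 \<le> t" "t \<le> N"
  shows "n \<ge> 1 \<Longrightarrow> n \<le> S t \<Longrightarrow> (\<Sum>s=1..n. w t s * gap t s)
    \<le> \<Phi>_start t - \<Phi> t n + (\<Sum>s=1..n. w t s * prox_terms t (y t s))"
proof (induction n rule: dec_induct)
  case base
  show ?case using gap_first[OF t] by simp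
next
  case (step n)
  then show ?case using gap_next[OF t, of n] by simp
qed

abbreviation "tangent t v \<equiv> f (xu t) + \<pi> t \<bullet> (v - xu t) + lr \<bullet> (g (xu t) + \<nu> t *v (v - xu t))"

text \<open>The inner multipliers drop out: they are nonnegative, and at a feasible point convexity makes
  every linearized constraint nonpositive.\<close>

lemma gap_ge:
  assumes t: "1 \<le> t" "t \<le> N" and s: "1 \<le> s" "s \<le> S t"
  shows "tangent t (y t s) + u (y t s) - (f xr + u xr) \<le> gap t s"
proof -
  have "lam t s \<bullet> (g (xu t) + \<nu> t *v (xr - xu t)) \<le> lam t s \<bullet> 0"
    using convex_above_jacobian_tangent[OF g, of "xu t" xr] xr(2)
    by (intro inner_nonneg_mono lam_nonneg[OF t s]) auto
  moreover have "f (xu t) + \<pi> t \<bullet> (xr - xu t) \<le> f xr"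
    by (intro convex_above_tangent f GDERIV_gradient)
  ultimately show ?thesis by (simp add: inner_diff_right)
qed

lemma phase_estimate:
  assumes t: "1 \<le> t" "t \<le> N"
  shows "\<omega> t * (tangent t (x t) + u (x t) - (f xr + u xr))
    \<le> \<Phi>_start t - \<Phi> t (S t) + \<omega> t * prox_terms t (x t)"
proof -
  let ?P = "\<lambda>v. tangent t v + u v - (f xr + u xr) - prox_terms t v"
  have cX: "convex X" using u(1) by (rule convex_on_imp_convex)
  have T: "convex_on X (\<lambda>v. tangent t v)"
    using cX by (intro convex_onI) (auto simp: inner_diff_right inner_add_right
        matrix_vector_mult_diff_distrib matrix_vector_right_distrib matrix_vector_mult_scaleR algebra_simps)
  have q: "convex_on X (\<lambda>v. \<eta> t / 2 * (norm (v - x (t - 1)))\<^sup>2)"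
    "convex_on X (\<lambda>v. (\<eta> t + \<alpha> / 2) / 2 * (norm (v - xr))\<^sup>2)"
    using eta_nonneg[OF t(1)] pos by (auto intro!: convex_on_cmul convex_on_norm_diff_square cX)
  have "convex_on X (\<lambda>v. tangent t v + u v + \<eta> t / 2 * (norm (v - x (t - 1)))\<^sup>2
      + (\<eta> t + \<alpha> / 2) / 2 * (norm (v - xr))\<^sup>2
      + (- (f xr + u xr) - \<eta> t / 2 * (norm (xr - x (t - 1)))\<^sup>2))"
    by (rule convex_on_add[OF convex_on_add[OF convex_on_add[OF convex_on_add[OF T u(1)] q(1)] q(2)]
          convex_on_const[THEN iffD2, OF cX]])
  then have "convex_on X ?P" by (simp add: norm_minus_commute[of xr] algebra_simps)
  then have "\<omega> t * ?P (x t) \<le> (\<Sum>s=1..S t. w t s * ?P (y t s))"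
    by (rule phase_Jensen[OF t])
  also have "\<dots> \<le> (\<Sum>s=1..S t. w t s * gap t s - w t s * prox_terms t (y t s))"
  proof (intro sum_mono)
    fix s assume s: "s \<in> {1..S t}"
    have "w t s * ?P (y t s) \<le> w t s * (gap t s - prox_terms t (y t s))"
      using gap_ge[OF t, of s] weight_pos[OF t, of s] s by (intro mult_left_mono) auto
    then show "w t s * ?P (y t s) \<le> w t s * gap t s - w t s * prox_terms t (y t s)"
      by (simp only: right_diff_distrib)
  qed
  also have "\<dots> \<le> \<Phi>_start t - \<Phi> t (S t)"
    using sum_gap[OF t S_ge_1[OF t] order_refl] by (simp only: sum_subtractf)
  finally show ?thesis by (simp only: right_diff_distrib)
qed

text \<open>Adding up the estimates of the phases and of the outer steps bounds the tangents of the
  Lagrangian at an arbitrary point \<open>xh\<close> along the iterates. The proximal terms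
  \<open>\<parallel>x t - x (t - 1)\<parallel>\<^sup>2\<close> cancel, and the distances to \<open>xr\<close> telescope because half of the strong
  convexity was kept for them.\<close>

lemma run_estimate:
  fixes xh :: "real^'n"
  defines "h \<equiv> \<lambda>v. f v + lr \<bullet> g v"
    and "G \<equiv> \<lambda>v. gradient f v + transpose (jacobian g (at v)) *v lr"
  assumes lip: "Lc-lipschitz_on UNIV G" and n: "1 \<le> n" "n \<le> N"
  shows "(\<Sum>t=1..n. \<omega> t * (h xh + G xh \<bullet> (x t - xh) + u (x t) - (f xr + u xr)))
      + \<Phi> n (S n) + outer_potential (\<omega> n) (\<tau> n) (\<eta> n) h G xh (xu n) (x n - x (n - 1))
      + \<omega> n * (\<eta> n + \<alpha> / 2) / 2 * (norm (xr - x n))\<^sup>2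
    \<le> K / 2 * (norm lr)\<^sup>2 + Lc * (norm (xr - x0))\<^sup>2"
proof -
  have conv: "convex_on UNIV h"
    unfolding h_def by (intro convex_on_lagrangian f g lr)
  have G: "GDERIV h z :> G z" for z
    unfolding h_def G_def by (intro GDERIV_lagrangian f g)
  have tangent: "tangent t v = h (xu t) + G (xu t) \<bullet> (v - xu t)" for t v
    by (simp add: h_def G_def inner_add_left inner_add_right dot_lmul_matrix)
  \<comment> \<open>addition of an outer step and the estimate of its phase, in which the terms with \<open>T1\<close>, \<open>T2\<close>
    (tangent at \<open>xu t\<close>) and \<open>B\<close> (last displacement) cancel\<close>
  have combine: "o1 * (H1 + H2 + U - F) + Q1 + P1 + o1 * (e + \<alpha> / 2) / 2 * C
      \<le> Q0 + P0 + o1 * e / 2 * A"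
    if "o1 * (H1 + H2 - T1 - T2) \<le> P0 - P1 + o1 * e / 2 * B"
      "o1 * (T1 + T2 + U - F) \<le> Q0 - Q1 + o1 * (e / 2 * A - e / 2 * B - (e + \<alpha> / 2) / 2 * C)"
    for o1 H1 H2 T1 T2 U F P0 P1 Q0 Q1 e A B C :: real
    using that by (simp add: algebra_simps)
  show ?thesis
    using n
  proof (induction n rule: dec_induct)
    case base
    have t: "1 \<le> (1::nat)" "1 \<le> N" using pos by auto
    have \<tau>1: "\<tau> 1 = 0" using kappa_pos by simp
    have \<tau>2: "\<tau> (1 + 1) = 1 / 2"
    proof -
      have "1 / 2 \<le> sqrt (2 * (Lc / \<alpha>))"
        by (rule real_le_rsqrt) (use \<kappa> in \<open>simp add: power2_eq_square\<close>)
      then show ?thesis by (simp add: tau_def)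
    qed
    have \<eta>1: "\<eta> 1 = 2 * Lc" unfolding eta_def \<tau>2 by simp
    have xu1: "xu 1 = x0"
      using xu_eq[OF t] initial \<tau>1 by simp
    have "\<omega> 1 * (h xh + G xh \<bullet> (x 1 - xh) - h (xu 1) - G (xu 1) \<bullet> (x 1 - xu 1))
      \<le> outer_potential 0 0 Lc h G xh (xu 0) 0
        - outer_potential (\<omega> 1) (\<tau> 1) (\<eta> 1) h G xh (xu 1) (x 1 - x (1 - 1))
        + \<omega> 1 * \<eta> 1 / 2 * (norm (x 1 - x (1 - 1)))\<^sup>2"
      using \<tau>1 xu1 initial
      by (intro outer_step[OF conv G lip Lc_pos, where \<theta> = 0]) auto
    from combine[OF this phase_estimate[OF t, unfolded tangent]]
    show ?case
      using initial \<eta>1 by (simp add: outer_potential_def[of 0])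
  next
    case (step n)
    have t: "1 \<le> Suc n" "Suc n \<le> N" using step by auto
    have n: "1 \<le> n" "n \<le> N" using step by auto
    have \<tau>n: "\<tau> (Suc n) \<ge> 0" "\<tau> n \<ge> 0" using tau_nonneg kappa_pos n by auto
    have xu: "(1 + \<tau> (Suc n)) *\<^sub>R xu (Suc n)
        = \<tau> (Suc n) *\<^sub>R xu n + (x n + theta (Lc / \<alpha>) (Suc n) *\<^sub>R (x n - x (n - 1)))"
      using xu_eq[OF t] \<tau>n n by (simp add: numeral_2_eq_2)
    have "\<omega> (Suc n) * (h xh + G xh \<bullet> (x (Suc n) - xh)
          - h (xu (Suc n)) - G (xu (Suc n)) \<bullet> (x (Suc n) - xu (Suc n)))
      \<le> outer_potential (\<omega> n) (\<tau> n) (\<eta> n) h G xh (xu n) (x n - x (n - 1))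
        - outer_potential (\<omega> (Suc n)) (\<tau> (Suc n)) (\<eta> (Suc n)) h G xh (xu (Suc n))
            (x (Suc n) - x (Suc n - 1))
        + \<omega> (Suc n) * \<eta> (Suc n) / 2 * (norm (x (Suc n) - x (Suc n - 1)))\<^sup>2"
      unfolding diff_Suc_1
    proof (rule outer_step[OF conv G lip Lc_pos xu])
      show "(\<omega> (Suc n) * theta (Lc / \<alpha>) (Suc n)) *\<^sub>R (x n - x (n - 1)) = \<omega> n *\<^sub>R (x n - x (n - 1))"
        using omega_mult_theta[OF kappa_pos n(1)] by simp
      show "\<omega> (Suc n) * \<tau> (Suc n) = \<omega> n * (1 + \<tau> n)"
        using omega_mult_tau[OF kappa_pos n(1)] by (simp add: add.commute)
    qed (use \<tau>n omega_pos[OF n(1)] omega_pos[OF t(1)] Lc_le_eta[OF n(1)] in auto)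
    note est = combine[OF this phase_estimate[OF t, unfolded tangent]]
    have "\<omega> (Suc n) * \<eta> (Suc n) / 2 * (norm (xr - x n))\<^sup>2
        \<le> \<omega> n * (\<eta> n + \<alpha> / 2) / 2 * (norm (xr - x n))\<^sup>2"
      using omega_mult_eta_le[OF pos(1) \<kappa> n(1)] by (intro mult_right_mono) auto
    moreover have "(if Suc n = 1 then K / 2 * (norm lr)\<^sup>2 else \<Phi> (Suc n - 1) (S (Suc n - 1))) = \<Phi> n (S n)"
      using n by simp
    moreover note step.IH[OF n(2)]
    ultimately show ?case
      using est unfolding diff_Suc_1 sum.nat_ivl_Suc'[OF t(1)] by linarith
  qed
qed

text \<open>At the end of the run both potentials are nonnegative. With the average of the iterates as
  \<open>xh\<close>, the tangents sum up to the value of the Lagrangian at that average.\<close>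

lemma ergodic_estimate:
  defines "xb \<equiv> \<lambda>n. ergodic_average (Lc / \<alpha>) x n"
  assumes lip: "Lc-lipschitz_on UNIV (\<lambda>v. gradient f v + transpose (jacobian g (at v)) *v lr)"
    and n: "1 \<le> n" "n \<le> N"
  shows "(\<Sum>t=1..n. \<omega> t) * (f (xb n) + lr \<bullet> g (xb n) + u (xb n) - (f xr + u xr))
      + \<alpha> / 4 * (norm (xr - x n))\<^sup>2
    \<le> Lc * (2 * (norm lr)\<^sup>2 / R\<^sup>2 + (norm (xr - x0))\<^sup>2)"
proof -
  define h where "h = (\<lambda>v. f v + lr \<bullet> g v)"
  define G where "G = (\<lambda>v. gradient f v + transpose (jacobian g (at v)) *v lr)"
  define A where "A = (\<Sum>t=1..n. \<omega> t)"
  let ?xb = "xb n"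
  have lipG: "Lc-lipschitz_on UNIV G" using lip by (simp add: G_def del: transpose_matrix_vector)
  have A: "A > 0" unfolding A_def using n omega_pos by (intro sum_pos) auto
  have xb: "?xb = (\<Sum>t=1..n. \<omega> t *\<^sub>R x t) /\<^sub>R A"
    by (simp add: xb_def ergodic_average_def A_def)
  have \<Phi>: "\<Phi> n (S n) \<ge> 0"
    using step_final[OF n S_ge_1[OF n]] weight_pos[OF n S_ge_1[OF n]] beta_nonneg[OF n S_ge_1[OF n]]
      pos K_nonneg by (intro inner_potential_nonneg[OF matrix_norm_le_M]) auto
  have "outer_potential (\<omega> n) (\<tau> n) (\<eta> n) h G ?xb (xu n) (x n - x (n - 1)) \<ge> 0"
  proof (rule outer_potential_nonneg[OF _ _ lipG Lc_pos])
    show "convex_on UNIV h" unfolding h_def by (intro convex_on_lagrangian f g lr)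
    show "GDERIV h z :> G z" for z unfolding h_def G_def by (intro GDERIV_lagrangian f g)
  qed (use omega_pos[OF n(1)] tau_nonneg[of "Lc / \<alpha>" n] kappa_pos n Lc_le_eta[OF n(1)] in auto)
  moreover have "(\<Sum>t=1..n. \<omega> t * (h ?xb + G ?xb \<bullet> (x t - ?xb) + u (x t) - (f xr + u xr)))
      + \<Phi> n (S n) + outer_potential (\<omega> n) (\<tau> n) (\<eta> n) h G ?xb (xu n) (x n - x (n - 1))
      + \<omega> n * (\<eta> n + \<alpha> / 2) / 2 * (norm (xr - x n))\<^sup>2
    \<le> K / 2 * (norm lr)\<^sup>2 + Lc * (norm (xr - x0))\<^sup>2"
    using run_estimate[OF lip n, of ?xb] unfolding h_def G_def .
  moreover have "A * (h ?xb + u ?xb - (f xr + u xr))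
      \<le> (\<Sum>t=1..n. \<omega> t * (h ?xb + G ?xb \<bullet> (x t - ?xb) + u (x t) - (f xr + u xr)))"
  proof -
    have "A * u ?xb \<le> (\<Sum>t=1..n. \<omega> t * u (x t))"
      unfolding xb using n A x_in_X omega_pos
      by (intro weighted_Jensen[OF u(1)]) (auto simp: A_def intro: less_imp_le)
    moreover have "(\<Sum>t=1..n. \<omega> t *\<^sub>R (x t - ?xb)) = 0"
    proof -
      have "(\<Sum>t=1..n. \<omega> t *\<^sub>R (x t - ?xb)) = (\<Sum>t=1..n. \<omega> t *\<^sub>R x t) - A *\<^sub>R ?xb"
        unfolding scaleR_right_diff_distrib sum_subtractf by (simp add: A_def scaleR_sum_left)
      then show ?thesis using A by (simp add: xb)
    qed
    then have "(\<Sum>t=1..n. \<omega> t * (G ?xb \<bullet> (x t - ?xb))) = 0"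
      by (metis (no_types, lifting) inner_scaleR_right inner_sum_right inner_zero_right sum.cong)
    moreover have "(\<Sum>t=1..n. \<omega> t * (h ?xb + G ?xb \<bullet> (x t - ?xb) + u (x t) - (f xr + u xr)))
      = (\<Sum>t=1..n. \<omega> t * (h ?xb - (f xr + u xr)) + \<omega> t * (G ?xb \<bullet> (x t - ?xb)) + \<omega> t * u (x t))"
      by (intro sum.cong refl) (simp add: algebra_simps)
    then have "(\<Sum>t=1..n. \<omega> t * (h ?xb + G ?xb \<bullet> (x t - ?xb) + u (x t) - (f xr + u xr)))
      = A * (h ?xb - (f xr + u xr)) + (\<Sum>t=1..n. \<omega> t * (G ?xb \<bullet> (x t - ?xb)))
        + (\<Sum>t=1..n. \<omega> t * u (x t))"
      unfolding sum.distrib A_def sum_distrib_right .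
    ultimately show ?thesis by (simp add: algebra_simps)
  qed
  moreover have "\<alpha> / 4 * (norm (xr - x n))\<^sup>2 \<le> \<omega> n * (\<eta> n + \<alpha> / 2) / 2 * (norm (xr - x n))\<^sup>2"
  proof -
    have "1 * (\<alpha> / 2) \<le> \<omega> n * (\<eta> n + \<alpha> / 2)"
      using omega_ge_1[OF kappa_pos n(1)] eta_nonneg[OF n(1)] pos by (intro mult_mono) auto
    then show ?thesis by (intro mult_right_mono) auto
  qed
  moreover have "K / 2 * (norm lr)\<^sup>2 = Lc * (2 * (norm lr)\<^sup>2 / R\<^sup>2)"
    using pos Lc_pos by (simp add: field_simps)
  ultimately have "A * (h ?xb + u ?xb - (f xr + u xr)) + \<alpha> / 4 * (norm (xr - x n))\<^sup>2
      \<le> Lc * (2 * (norm lr)\<^sup>2 / R\<^sup>2) + Lc * (norm (xr - x0))\<^sup>2"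
    using \<Phi> by linarith
  then show ?thesis unfolding A_def h_def by (simp add: distrib_left)
qed

end

lemma ergodic_average_in_X:
  assumes "1 \<le> n" "n \<le> N"
  shows "ergodic_average (Lc / \<alpha>) x n \<in> X"
proof -
  have "(\<Sum>t=1..n. \<omega> t) > 0" using assms omega_pos by (intro sum_pos) auto
  then show ?thesis
    unfolding ergodic_average_def using assms x_in_X omega_pos
    by (intro weighted_Jensen(2)[OF u(1)]) (auto intro: less_imp_le)
qed

text \<open>The points at which gradients are evaluated are averages of extrapolations
  \<open>x + \<theta> (x - x')\<close> with \<open>\<theta> \<le> 1\<close>.\<close>

lemma xu_bounded:
  assumes x: "\<And>n. n \<le> N \<Longrightarrow> norm (x n - p) \<le> r"
  shows "t \<le> N \<Longrightarrow> norm (xu t - p) \<le> 3 * r"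
proof (induction t)
  case 0
  have "0 \<le> r" using x[of 0] norm_ge_zero[of "x 0 - p"] by linarith
  then show ?case using x[of 0] initial by simp
next
  case (Suc t)
  have t: "1 \<le> Suc t" "Suc t \<le> N" using Suc by auto
  let ?\<tau> = "\<tau> (Suc t)" and ?\<theta> = "theta (Lc / \<alpha>) (Suc t)" and ?x' = "x (Suc t - 2)"
  have \<tau>: "?\<tau> \<ge> 0" using tau_nonneg kappa_pos by auto
  have \<theta>: "0 \<le> ?\<theta>" "?\<theta> \<le> 1" using theta_nonneg theta_le_1 kappa_pos by auto
  have "(1 + ?\<tau>) *\<^sub>R xu (Suc t) = ?\<tau> *\<^sub>R xu t + (x t + ?\<theta> *\<^sub>R (x t - ?x'))"
    using xu_eq[OF t] \<tau> by simp
  then have eq: "(1 + ?\<tau>) *\<^sub>R (xu (Suc t) - p)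
      = ?\<tau> *\<^sub>R (xu t - p) + ((x t - p) + ?\<theta> *\<^sub>R ((x t - p) - (?x' - p)))"
    by (simp add: algebra_simps)
  have xt: "norm (x t - p) \<le> r" "norm (?x' - p) \<le> r" using x t by auto
  have "norm ((x t - p) - (?x' - p)) \<le> 2 * r"
    using norm_triangle_ineq4[of "x t - p" "?x' - p"] xt by linarith
  then have "?\<theta> * norm ((x t - p) - (?x' - p)) \<le> 1 * (2 * r)"
    using \<theta> by (intro mult_mono) auto
  moreover have "?\<tau> * norm (xu t - p) \<le> ?\<tau> * (3 * r)"
    using Suc \<tau> by (intro mult_left_mono) auto
  moreover have "norm ((1 + ?\<tau>) *\<^sub>R (xu (Suc t) - p))
      \<le> ?\<tau> * norm (xu t - p) + (norm (x t - p) + ?\<theta> * norm ((x t - p) - (?x' - p)))"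
    unfolding eq using \<tau> \<theta>
    by (intro order_trans[OF norm_triangle_ineq] add_mono) (auto intro!: order_trans[OF norm_triangle_ineq])
  moreover have "norm ((1 + ?\<tau>) *\<^sub>R (xu (Suc t) - p)) = (1 + ?\<tau>) * norm (xu (Suc t) - p)"
    using \<tau> by simp
  moreover have "?\<tau> * (3 * r) + (r + 1 * (2 * r)) = (1 + ?\<tau>) * (3 * r)"
    by (simp add: algebra_simps)
  ultimately have "(1 + ?\<tau>) * norm (xu (Suc t) - p) \<le> (1 + ?\<tau>) * (3 * r)"
    using xt(1) by linarith
  then show ?case using \<tau> by simp
qed

end

section \<open>The saddle point and the final bounds\<close>

text \<open>Subgradient inequalities for \<open>f\<close>, the \<open>g\<^sub>i\<close> and \<open>u\<close> at \<open>x_star\<close> are added with the weights of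
  the KKT condition; only \<open>u\<close> contributes a quadratic term.\<close>

lemma lagrangian_growth:
  fixes f u :: "real^'n \<Rightarrow> real" and g :: "real^'n \<Rightarrow> real^'m"
  assumes f: "convex_on UNIV f" "f differentiable (at x_star)"
    and g: "\<And>i. convex_on UNIV (\<lambda>x. g x $ i)" "g differentiable (at x_star)"
    and u: "strongly_convex_on X \<alpha> u" and x_star: "x_star \<in> X"
    and KKT: "0 \<le> lam_star" "\<And>i. lam_star $ i * g x_star $ i = 0"
      "u' \<in> subdifferential_on X u x_star"
      "- (gradient f x_star + (\<Sum>i\<in>UNIV. lam_star $ i *\<^sub>R gradient (\<lambda>x. g x $ i) x_star) + u')
         \<in> normal_cone X x_star"
    and v: "v \<in> X"
  shows "f x_star + u x_star + \<alpha> / 2 * (norm (v - x_star))\<^sup>2 \<le> f v + lam_star \<bullet> g v + u v"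
proof -
  let ?s = "\<Sum>i\<in>UNIV. lam_star $ i *\<^sub>R gradient (\<lambda>x. g x $ i) x_star"
  have "f x_star + gradient f x_star \<bullet> (v - x_star) \<le> f v"
    by (intro convex_above_tangent f GDERIV_gradient)
  moreover have "?s \<bullet> (v - x_star) \<le> lam_star \<bullet> g v"
  proof -
    have "?s \<bullet> (v - x_star) = (\<Sum>i\<in>UNIV. lam_star $ i * (gradient (\<lambda>x. g x $ i) x_star \<bullet> (v - x_star)))"
      by (simp add: inner_sum_left)
    also have "\<dots> = (\<Sum>i\<in>UNIV. lam_star $ i * (g x_star $ i + gradient (\<lambda>x. g x $ i) x_star \<bullet> (v - x_star)))"
      by (intro sum.cong refl) (simp only: distrib_left KKT(2) add_0_left)
    also have "\<dots> \<le> (\<Sum>i\<in>UNIV. lam_star $ i * g v $ i)"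
      using KKT(1) by (intro sum_mono mult_left_mono convex_above_tangent g jacobian_component(2))
        (auto simp: less_eq_vec_def)
    finally show ?thesis by (simp add: inner_vec_def)
  qed
  moreover have "u x_star + u' \<bullet> (v - x_star) + \<alpha> / 2 * (norm (v - x_star))\<^sup>2 \<le> u v"
    by (rule strongly_convex_subgradient_gap[OF u KKT(3) x_star v])
  moreover have "- (gradient f x_star + ?s + u') \<bullet> (v - x_star) \<le> 0"
    using KKT(4) v unfolding normal_cone_def by blast
  ultimately show ?thesis
    unfolding inner_minus_left inner_add_left by linarith
qed

lemma jacobian_bounded_on_cball:
  fixes g :: "real^'n \<Rightarrow> real^'m"
  assumes g: "\<And>v. g differentiable (at v)"
    and lip: "\<And>i. \<exists>K. K-lipschitz_on UNIV (gradient (\<lambda>x. g x $ i))"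
  shows "bdd_above ((\<lambda>z. max 1 (matrix_norm (jacobian g (at z)))) ` cball p r)"
proof -
  obtain K where K: "\<And>i. (K i)-lipschitz_on UNIV (gradient (\<lambda>x. g x $ i))"
    using lip by metis
  define B where "B = (\<Sum>i\<in>UNIV. norm (gradient (\<lambda>x. g x $ i) p) + K i * r)"
  have "matrix_norm (jacobian g (at z)) \<le> B" if z: "z \<in> cball p r" for z
    unfolding matrix_norm_def
  proof (rule onorm_le)
    fix v
    have "norm (jacobian g (at z) *v v) \<le> (\<Sum>i\<in>UNIV. \<bar>(jacobian g (at z) *v v) $ i\<bar>)"
      by (rule norm_le_l1_cart)
    also have "\<dots> \<le> (\<Sum>i\<in>UNIV. (norm (gradient (\<lambda>x. g x $ i) p) + K i * r) * norm v)"
    proof (rule sum_mono)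
      fix i
      let ?G = "gradient (\<lambda>x. g x $ i)"
      have "\<bar>(jacobian g (at z) *v v) $ i\<bar> \<le> norm (?G z) * norm v"
        unfolding jacobian_component(1)[OF g] by (rule Cauchy_Schwarz_ineq2)
      also have "\<dots> \<le> (norm (?G p) + K i * r) * norm v"
      proof (rule mult_right_mono)
        have "norm (?G z - ?G p) \<le> K i * norm (z - p)"
          using lipschitz_onD[OF K, of z p i] by (simp add: dist_norm)
        also have "\<dots> \<le> K i * r"
          using z lipschitz_on_nonneg[OF K] by (intro mult_left_mono) (auto simp: dist_norm norm_minus_commute)
        finally show "norm (?G z) \<le> norm (?G p) + K i * r"
          using norm_triangle_ineq2[of "?G z" "?G p"] by linarith
      qed simp
      finally show "\<bar>(jacobian g (at z) *v v) $ i\<bar> \<le> (norm (?G p) + K i * r) * norm v" .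
    qed
    finally show "norm (jacobian g (at z) *v v) \<le> B * norm v"
      by (simp add: B_def sum_distrib_right)
  qed
  then show ?thesis by (intro bdd_aboveI2[of _ _ "max 1 B"]) (auto simp: max.coboundedI2)
qed

lemma pos_part_nonneg: "0 \<le> pos_part v"
  by (simp add: pos_part_def less_eq_vec_def)

lemma pos_part_inner: "pos_part v \<bullet> v = (norm (pos_part v))\<^sup>2"
  unfolding power2_norm_eq_inner inner_vec_def
  by (intro sum.cong refl) (auto simp: pos_part_def max_def)

theorem theorem6:
  fixes f u :: "real^'n \<Rightarrow> real" and g :: "real^'n \<Rightarrow> real^'m" and X :: "(real^'n) set"
    and \<alpha> c R :: real and x0 x_star :: "real^'n" and lam_star :: "real^'m"
    and L :: "real^'m \<Rightarrow> real"
    and F :: "real^'n \<Rightarrow> real" and Lc \<kappa> d :: real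
  assumes defs: "F = (\<lambda>x. f x + u x)" "Lc = (SUP l\<in>multiplier_set lam_star c. L l)"
      "\<kappa> = Lc / \<alpha>" "d = norm lam_star + c"
    and X: "closed X" "convex X"
    and f: "convex_on UNIV f" "\<forall>x. f differentiable (at x)"
      "\<exists>K. K-lipschitz_on UNIV (gradient f)"
    and g: "\<forall>i. convex_on UNIV (\<lambda>x. g x $ i)" "\<forall>x. g differentiable (at x)"
      "\<forall>i. \<exists>K. K-lipschitz_on UNIV (gradient (\<lambda>x. g x $ i))"
    and u: "convex_on X u" "strongly_convex_on X \<alpha> u"
    and params: "\<alpha> > 0" "c \<ge> 1" "R > 0"
    and optimal: "x_star \<in> X" "g x_star \<le> 0" "\<forall>x\<in>X. g x \<le> 0 \<longrightarrow> F x_star \<le> F x"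
    and KKT: "0 \<le> lam_star" "\<forall>i. lam_star $ i * g x_star $ i = 0"
      "\<exists>u'\<in>subdifferential_on X u x_star.
         - (gradient f x_star + (\<Sum>i\<in>UNIV. lam_star $ i *\<^sub>R gradient (\<lambda>x. g x $ i) x_star) + u')
           \<in> normal_cone X x_star"
    and L: "\<forall>l. 0 \<le> l \<longrightarrow>
        (L l)-lipschitz_on UNIV (gradient (\<lambda>x. f x + (\<Sum>i\<in>UNIV. l $ i * g x $ i)))"
      "bdd_above (L ` multiplier_set lam_star c)" "L 0 \<ge> \<alpha>"
    and x0: "x0 \<in> X"
  shows "\<exists>U. bounded U \<and> x_star \<in> interior U \<and>
    bdd_above ((\<lambda>z. max 1 (matrix_norm (jacobian g (at z)))) ` U) \<and>
    (\<forall>N\<ge>1. \<forall>x xu y lam lamm S \<Gamma> W.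
       acgd_s_run f g u X \<alpha> Lc R x0 N x xu y lam lamm S \<Gamma> W \<longrightarrow>
       (let W\<^sub>N = (\<Sum>t=1..N. omega \<kappa> t);
            x_avg = ergodic_average \<kappa> x N;
            B = 2 * d\<^sup>2 / R\<^sup>2 + (norm (x0 - x_star))\<^sup>2
        in (\<forall>M_bar. (\<forall>z\<in>U. max 1 (matrix_norm (jacobian g (at z))) \<le> M_bar) \<longrightarrow>
              (\<forall>t\<in>{1..N}. phase_M g xu t \<le> M_bar)) \<and>
           max (F x_avg - F x_star) (c * norm (pos_part (g x_avg))) \<le> Lc / W\<^sub>N * B \<and>
           (norm (x_avg - x_star))\<^sup>2 \<le> 2 * Lc / (\<alpha> * W\<^sub>N) * B \<and>
           W\<^sub>N \<ge> max (real N * (real N + 1) / 2)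
                   (sqrt (2 * \<kappa>) * ((1 + 1 / sqrt (2 * \<kappa>)) powi (int N - 4) - 1))))"
proof -
  note F = defs(1) and Lc_eq = defs(2) and \<kappa>_eq = defs(3) and d_eq = defs(4)
  obtain u' where u': "u' \<in> subdifferential_on X u x_star"
    "- (gradient f x_star + (\<Sum>i\<in>UNIV. lam_star $ i *\<^sub>R gradient (\<lambda>x. g x $ i) x_star) + u')
       \<in> normal_cone X x_star"
    using KKT(3) by blast
  have growth: "F x_star + \<alpha> / 2 * (norm (v - x_star))\<^sup>2 \<le> f v + lam_star \<bullet> g v + u v" if "v \<in> X" for v
    unfolding F using f(1) f(2)[rule_format] g(1)[rule_format] g(2)[rule_format] u(2) optimal(1) KKT(1)
      KKT(2)[rule_format] u' that by (rule lagrangian_growth)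
  have L_le: "L l \<le> Lc" if "l \<in> multiplier_set lam_star c" for l
    unfolding Lc_eq using that L(2) by (rule cSUP_upper)
  have Lc: "Lc \<ge> \<alpha>" using L_le[of 0] L(3) by (simp add: multiplier_set_def)
  have Lc0: "Lc > 0" using Lc params by linarith
  have lip: "Lc-lipschitz_on UNIV (\<lambda>v. gradient f v + transpose (jacobian g (at v)) *v l)"
    if l: "l \<in> multiplier_set lam_star c" "0 \<le> l" for l
  proof -
    have sum: "(\<lambda>x. f x + (\<Sum>i\<in>UNIV. l $ i * g x $ i)) = (\<lambda>x. f x + l \<bullet> g x)"
      by (simp add: inner_vec_def)
    have "gradient (\<lambda>x. f x + (\<Sum>i\<in>UNIV. l $ i * g x $ i))
        = (\<lambda>v. gradient f v + transpose (jacobian g (at v)) *v l)"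
      unfolding sum
      by (intro ext gradient_eqI GDERIV_lagrangian f(2)[rule_format] g(2)[rule_format])
    moreover have "(L l)-lipschitz_on UNIV (gradient (\<lambda>x. f x + (\<Sum>i\<in>UNIV. l $ i * g x $ i)))"
      using L(1) l(2) by blast
    ultimately have "(L l)-lipschitz_on UNIV (\<lambda>v. gradient f v + transpose (jacobian g (at v)) *v l)"
      by (simp only:)
    then show ?thesis using L_le[OF l(1)] by (rule lipschitz_on_le)
  qed
  have mult_0: "0 \<in> multiplier_set lam_star c" by (simp add: multiplier_set_def)
  have mult_star: "lam_star \<in> multiplier_set lam_star c"
    using params by (auto simp: multiplier_set_def intro!: exI[of _ 0])
  define B where "B = 2 * d\<^sup>2 / R\<^sup>2 + (norm (x0 - x_star))\<^sup>2"
  have B_ge: "Lc * (2 * (norm l)\<^sup>2 / R\<^sup>2 + (norm (x_star - x0))\<^sup>2) \<le> Lc * B" if "norm l \<le> d" for l :: "real^'m"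
  proof -
    have "2 * (norm l)\<^sup>2 / R\<^sup>2 \<le> 2 * d\<^sup>2 / R\<^sup>2"
      using that by (intro divide_right_mono mult_left_mono power_mono) auto
    then show ?thesis
      using Lc0 unfolding B_def norm_minus_commute[of x_star x0] by (intro mult_left_mono) auto
  qed
  have star_le_d: "norm lam_star \<le> d" using params by (simp add: d_eq)
  define r where "r = sqrt (4 * Lc * B / \<alpha>)"
  let ?U = "cball x_star (3 * r + 1)"
  have B0: "0 \<le> (norm (x0 - x_star))\<^sup>2" "(norm (x0 - x_star))\<^sup>2 \<le> B" by (auto simp: B_def)
  then have "0 \<le> B" by linarith
  have r0: "r \<ge> 0" using Lc0 \<open>0 \<le> B\<close> params unfolding r_def by simp
  have U: "bounded ?U" "x_star \<in> interior ?U" using r0 by auto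
  have bdd: "bdd_above ((\<lambda>z. max 1 (matrix_norm (jacobian g (at z)))) ` ?U)"
    using g by (intro jacobian_bounded_on_cball) auto
  have run_bounds: "(\<forall>M_bar. (\<forall>z\<in>?U. max 1 (matrix_norm (jacobian g (at z))) \<le> M_bar) \<longrightarrow>
        (\<forall>t\<in>{1..N}. phase_M g xu t \<le> M_bar)) \<and>
      max (F (ergodic_average \<kappa> x N) - F x_star) (c * norm (pos_part (g (ergodic_average \<kappa> x N))))
        \<le> Lc / (\<Sum>t=1..N. omega \<kappa> t) * B \<and>
      (norm (ergodic_average \<kappa> x N - x_star))\<^sup>2 \<le> 2 * Lc / (\<alpha> * (\<Sum>t=1..N. omega \<kappa> t)) * B \<and>
      (\<Sum>t=1..N. omega \<kappa> t) \<ge> max (real N * (real N + 1) / 2)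
                   (sqrt (2 * \<kappa>) * ((1 + 1 / sqrt (2 * \<kappa>)) powi (int N - 4) - 1))"
    if N: "N \<ge> 1" and run: "acgd_s_run f g u X \<alpha> Lc R x0 N x xu y lam lamm S \<Gamma> W"
    for N x xu y lam lamm S \<Gamma> W
  proof -
    interpret run: acgd_s f u g X \<alpha> Lc R x0 N x xu y lam lamm S \<Gamma> W
      using f g u params Lc N run by unfold_locales auto
    let ?W = "\<lambda>n. \<Sum>t=1..n. omega \<kappa> t" and ?xb = "\<lambda>n. ergodic_average \<kappa> x n"
    have \<kappa>1: "\<kappa> \<ge> 1" unfolding \<kappa>_eq by (rule run.\<kappa>)
    have W_pos: "?W n > 0" if "1 \<le> n" for n
      using that run.omega_pos unfolding \<kappa>_eq by (intro sum_pos) auto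
    have main: "?W n * (f (?xb n) + l \<bullet> g (?xb n) + u (?xb n) - F x_star)
        + \<alpha> / 4 * (norm (x_star - x n))\<^sup>2 \<le> Lc * B"
      if "l \<in> multiplier_set lam_star c" "0 \<le> l" "norm l \<le> d" "1 \<le> n" "n \<le> N" for l n
      using run.ergodic_estimate[OF optimal(1,2) that(2) lip[OF that(1,2)] that(4,5)] B_ge[OF that(3)]
      unfolding \<kappa>_eq F by linarith
    have xb: "?xb n \<in> X" if "1 \<le> n" "n \<le> N" for n
      using run.ergodic_average_in_X[OF that] by (simp add: \<kappa>_eq)
    have x_near: "norm (x n - x_star) \<le> r" if "n \<le> N" for n
    proof -
      have "\<alpha> / 4 * (norm (x n - x_star))\<^sup>2 \<le> Lc * B"
      proof (cases "n = 0")
        case True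
        have "\<alpha> / 4 * (norm (x0 - x_star))\<^sup>2 \<le> Lc * B"
          using Lc params B0 by (intro mult_mono) auto
        then show ?thesis using True run.initial by simp
      next
        case False
        have "0 \<le> \<alpha> / 2 * (norm (?xb n - x_star))\<^sup>2" using params by simp
        then have "0 \<le> ?W n * (f (?xb n) + lam_star \<bullet> g (?xb n) + u (?xb n) - F x_star)"
          using growth[OF xb, of n] W_pos[of n] that False by (intro mult_nonneg_nonneg) auto
        then show ?thesis
          using main[OF mult_star KKT(1) star_le_d, of n] that False
          unfolding norm_minus_commute[of "x n"] by linarith
      qed
      then show ?thesis
        unfolding r_def using params by (intro real_le_rsqrt) (simp add: field_simps)
    qed
    have phase_M_le: "phase_M g xu t \<le> M_bar"
      if M_bar: "\<forall>z\<in>?U. max 1 (matrix_norm (jacobian g (at z))) \<le> M_bar" and t: "t \<in> {1..N}" for M_bar t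
    proof -
      have "norm (xu t - x_star) \<le> 3 * r" using run.xu_bounded[OF x_near, of t] t by simp
      then have "xu t \<in> ?U" by (simp add: dist_norm norm_minus_commute)
      then have "max 1 (matrix_norm (jacobian g (at (xu t)))) \<le> M_bar" using M_bar by blast
      then show ?thesis by (simp add: phase_M_def Let_def)
    qed
    have "F (?xb N) - F x_star \<le> Lc / ?W N * B"
    proof -
      have "?W N * (F (?xb N) - F x_star) + \<alpha> / 4 * (norm (x_star - x N))\<^sup>2 \<le> Lc * B"
        using main[OF mult_0, of N] N star_le_d norm_ge_zero[of lam_star] unfolding F by simp
      moreover have "0 \<le> \<alpha> / 4 * (norm (x_star - x N))\<^sup>2" using params by simp
      ultimately have "?W N * (F (?xb N) - F x_star) \<le> Lc * B" by linarith
      then show ?thesis using W_pos[OF N] by (simp add: field_simps)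
    qed
    moreover have "c * norm (pos_part (g (?xb N))) \<le> Lc / ?W N * B"
    proof (cases "pos_part (g (?xb N)) = 0")
      case True
      then show ?thesis using Lc0 W_pos[OF N] \<open>0 \<le> B\<close> by simp
    next
      case False
      let ?p = "pos_part (g (?xb N))"
      \<comment> \<open>the direction in which a multiplier of length \<open>c\<close> detects the full constraint violation\<close>
      define l where "l = (c / norm ?p) *\<^sub>R ?p"
      have l: "0 \<le> l" "norm l = c"
        using False params pos_part_nonneg[of "g (?xb N)"] by (auto simp: l_def less_eq_vec_def)
      have violation: "l \<bullet> g (?xb N) = c * norm ?p"
        using False by (simp add: l_def pos_part_inner power2_eq_square)
      have "lam_star + l \<in> multiplier_set lam_star c" using l by (auto simp: multiplier_set_def)
      moreover have "0 \<le> lam_star + l" using l KKT(1) by simp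
      moreover have "norm (lam_star + l) \<le> d"
        using norm_triangle_ineq[of lam_star l] l by (simp add: d_eq)
      ultimately have "?W N * (f (?xb N) + (lam_star + l) \<bullet> g (?xb N) + u (?xb N) - F x_star)
        + \<alpha> / 4 * (norm (x_star - x N))\<^sup>2 \<le> Lc * B"
        using N by (intro main) auto
      moreover have "0 \<le> \<alpha> / 2 * (norm (?xb N - x_star))\<^sup>2" using params by simp
      then have "?W N * (c * norm ?p)
          \<le> ?W N * (f (?xb N) + (lam_star \<bullet> g (?xb N) + c * norm ?p) + u (?xb N) - F x_star)"
        using growth[OF xb[OF N order_refl]] W_pos[OF N] by (intro mult_left_mono) auto
      moreover have "0 \<le> \<alpha> / 4 * (norm (x_star - x N))\<^sup>2" using params by simp
      ultimately have "?W N * (c * norm ?p) \<le> Lc * B"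
        unfolding inner_add_left violation by linarith
      then show ?thesis using W_pos[OF N] by (simp add: field_simps)
    qed
    ultimately have gaps: "max (F (?xb N) - F x_star) (c * norm (pos_part (g (?xb N)))) \<le> Lc / ?W N * B"
      by (rule max.boundedI)
    have dist: "(norm (?xb N - x_star))\<^sup>2 \<le> 2 * Lc / (\<alpha> * ?W N) * B"
    proof -
      have "?W N * (\<alpha> / 2 * (norm (?xb N - x_star))\<^sup>2)
          \<le> ?W N * (f (?xb N) + lam_star \<bullet> g (?xb N) + u (?xb N) - F x_star)"
        using growth[OF xb[OF N order_refl]] W_pos[OF N] by (intro mult_left_mono) auto
      moreover have "0 \<le> \<alpha> / 4 * (norm (x_star - x N))\<^sup>2" using params by simp
      ultimately have "?W N * (\<alpha> / 2 * (norm (?xb N - x_star))\<^sup>2) \<le> Lc * B"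
        using main[OF mult_star KKT(1) star_le_d N order_refl] by linarith
      then show ?thesis using W_pos[OF N] params by (simp add: field_simps)
    qed
    show ?thesis
      using phase_M_le by (intro conjI gaps dist sum_omega_ge[OF \<kappa>1 N]) blast
  qed
  show ?thesis
    unfolding Let_def B_def[symmetric]
    by (intro exI[of _ ?U] conjI U bdd) (intro allI impI, rule run_bounds)
qed

end
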